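(* Let $K$ be an algebraically closed field of characteristic zero and let $C\subset\mathbb{P}^2(K)$ be a non-singular projective plane curve of degree $d\geq 4$. Then $C$ has an automorphism of order $(d-1)^2$ if and only if it is isomorphic to $X^d+Y^{d-1}Z+\alpha XZ^{d-1}=0$ for some $\alpha\in K$, $\alpha\neq 0$. In particular, in this case $Aut(C)$ is cyclic of order $(d-1)^2$; moreover, if $G$ is a non-cyclic automorphism group of a non-singular plane curve of degree $d$ with $(d-1)^2$ dividing $|G|$, then $G$ does not contain any element of order $(d-1)^2$.
   Context: $Aut(C)$ is the full automorphism group of $C$ over $K$, identified with the finite subgroup of $PGL_3(K)$ preserving the defining equation of $C$. Isomorphic non-singular plane curves of degree $d\ge 4$ are projectively equivalent. *)

theory Defs
  imports
    "HOL-Analysis.Analysis"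
    "HOL-Algebra.Algebra"
    "HOL-Library.Poly_Mapping"
    "HOL-Computational_Algebra.Polynomial"
begin

section \<open>Ternary polynomials\<close>

text \<open>
  The ring \<open>K[X, Y, Z]\<close> with its convolution product from \<open>Poly_Mapping\<close>.  The variables are
  indexed by the three-element type \<open>3\<close>, whose elements are \<open>1\<close>, \<open>2\<close> and \<open>3 = 0\<close>;
  \<open>X\<close>, \<open>Y\<close>, \<open>Z\<close> are \<open>Var 1\<close>, \<open>Var 2\<close>, \<open>Var 3\<close>.
\<close>

type_synonym 'k tpoly = "(3 \<Rightarrow>\<^sub>0 nat) \<Rightarrow>\<^sub>0 'k"

definition Var :: "3 \<Rightarrow> 'k::field tpoly" where
  "Var i = Poly_Mapping.single (Poly_Mapping.single i 1) 1"

definition Const :: "'k::field \<Rightarrow> 'k tpoly" where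
  "Const c = Poly_Mapping.single 0 c"

definition poly_at :: "'k::field tpoly \<Rightarrow> 'k^3 \<Rightarrow> 'k" where
  "poly_at F v =
     (\<Sum>m\<in>Poly_Mapping.keys F. Poly_Mapping.lookup F m * (\<Prod>i\<in>UNIV. (v $ i) ^ Poly_Mapping.lookup m i))"

text \<open>\<open>lin_subst A F\<close> is the polynomial \<open>F (A (X, Y, Z)\<^sup>T)\<close>.\<close>

definition lin_subst :: "'k::field^3^3 \<Rightarrow> 'k tpoly \<Rightarrow> 'k tpoly" where
  "lin_subst A F =
     (\<Sum>m\<in>Poly_Mapping.keys F. Const (Poly_Mapping.lookup F m) *
        (\<Prod>i\<in>UNIV. (\<Sum>j\<in>UNIV. Const (A $ i $ j) * Var j) ^ Poly_Mapping.lookup m i))"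

text \<open>
  If the exponent of the variable is zero in \<open>m\<close>, the truncated subtraction is irrelevant,
  as the new coefficient is zero.
\<close>

definition partial_deriv :: "3 \<Rightarrow> 'k::field tpoly \<Rightarrow> 'k tpoly" where
  "partial_deriv i F =
     (\<Sum>m\<in>Poly_Mapping.keys F. Poly_Mapping.single (m - Poly_Mapping.single i 1)
        (of_nat (Poly_Mapping.lookup m i) * Poly_Mapping.lookup F m))"

definition homogeneous :: "nat \<Rightarrow> 'k::field tpoly \<Rightarrow> bool" where
  "homogeneous d F \<longleftrightarrow> (\<forall>m\<in>Poly_Mapping.keys F. (\<Sum>i\<in>UNIV. Poly_Mapping.lookup m i) = d)"


section \<open>Non-singular plane curves\<close>

text \<open>
  A plane curve of degree \<open>d\<close> over an algebraically closed field is given by its defining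
  form \<open>F\<close>, unique up to a non-zero scalar factor.  Points of the projective plane are
  non-zero vectors up to scaling.
\<close>

definition nonsingular_plane_curve :: "nat \<Rightarrow> 'k::field tpoly \<Rightarrow> bool" where
  "nonsingular_plane_curve d F \<longleftrightarrow>
     F \<noteq> 0 \<and> homogeneous d F \<and>
     (\<forall>p. p \<noteq> 0 \<and> poly_at F p = 0 \<longrightarrow> (\<exists>i. poly_at (partial_deriv i F) p \<noteq> 0))"

text \<open>
  For non-singular plane curves of degree at least \<open>4\<close>, every isomorphism between two such
  curves is induced by a projective change of coordinates, so isomorphism is taken to be
  projective equivalence; likewise automorphisms are taken in the projective linear group.
\<close>

definition isomorphic_curves :: "'k::field tpoly \<Rightarrow> 'k tpoly \<Rightarrow> bool" where
  "isomorphic_curves F G \<longleftrightarrow>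
     (\<exists>A c. invertible A \<and> c \<noteq> 0 \<and> lin_subst A F = Const c * G)"


section \<open>The projective linear group and automorphism groups\<close>

definition GL3 :: "('k::field^3^3) monoid" where
  "GL3 = \<lparr>carrier = {A. invertible A}, monoid.mult = (**), one = mat 1\<rparr>"

definition scalar_matrices :: "('k::field^3^3) set" where
  "scalar_matrices = {mat c | c. c \<noteq> 0}"

definition PGL3 :: "('k::field^3^3) set monoid" where
  "PGL3 = GL3 Mod scalar_matrices"

text \<open>
  Preservation of \<open>F\<close> up to a scalar does not depend on the representative \<open>A\<close> of the
  class \<open>T\<close> when \<open>F\<close> is homogeneous.
\<close>

definition Aut :: "'k::field tpoly \<Rightarrow> ('k^3^3) set monoid" where
  "Aut F = PGL3\<lparr>carrier :=
     {T \<in> carrier PGL3. \<exists>A\<in>T. \<exists>c. c \<noteq> 0 \<and> lin_subst A F = Const c * F}\<rparr>"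

definition model_form :: "nat \<Rightarrow> 'k::field \<Rightarrow> 'k tpoly" where
  "model_form d \<alpha> =
     Var 1 ^ d + Var 2 ^ (d - 1) * Var 3 + Const \<alpha> * Var 1 * Var 3 ^ (d - 1)"

lemma group_GL3: "group (GL3 :: ('k::field^3^3) monoid)"
proof (rule groupI)
  fix A B :: "'k^3^3" assume "A \<in> carrier GL3" "B \<in> carrier GL3"
  then show "A \<otimes>\<^bsub>GL3\<^esub> B \<in> carrier GL3"
    by (simp add: GL3_def invertible_mult)
next
  fix A :: "'k^3^3" assume "A \<in> carrier GL3"
  then obtain B where "A ** B = mat 1" "B ** A = mat 1"
    by (auto simp: GL3_def invertible_def)
  then show "\<exists>B\<in>carrier GL3. B \<otimes>\<^bsub>GL3\<^esub> A = \<one>\<^bsub>GL3\<^esub>"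
    by (auto simp: GL3_def invertible_def)
qed (auto simp: GL3_def matrix_mul_assoc invertible_def intro: exI[of _ "mat 1"])

lemma mat_mult_mat: "mat a ** mat b = (mat (a * b) :: 'k::field^3^3)"
  by (simp add: vec_eq_iff matrix_matrix_mult_def mat_def if_distrib[where f = "\<lambda>x. x * _"]
      if_distrib[where f = "\<lambda>x. _ * x"] cong: if_cong)

lemma mat_mult_commute: "mat a ** A = A ** (mat a :: 'k::field^3^3)"
  by (simp add: vec_eq_iff matrix_matrix_mult_def mat_def if_distrib[where f = "\<lambda>x. x * _"]
      if_distrib[where f = "\<lambda>x. _ * x"] mult.commute cong: if_cong)

lemma scalar_matrices_normal: "(scalar_matrices :: ('k::field^3^3) set) \<lhd> GL3"
proof -
  interpret GL: group "GL3 :: ('k^3^3) monoid" by (rule group_GL3)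
  have inv: "mat a \<in> carrier (GL3 :: ('k^3^3) monoid)" if "a \<noteq> 0" for a
  proof -
    have "mat a ** mat (inverse a) = (mat 1 :: 'k^3^3)" "mat (inverse a) ** mat a = (mat 1 :: 'k^3^3)"
      using that by (simp_all add: mat_mult_mat)
    then show ?thesis by (auto simp: GL3_def invertible_def)
  qed
  have sub: "subgroup scalar_matrices (GL3 :: ('k^3^3) monoid)"
  proof (rule GL.subgroupI)
    show "scalar_matrices \<subseteq> carrier (GL3 :: ('k^3^3) monoid)"
      using inv by (auto simp: scalar_matrices_def)
    show "(scalar_matrices :: ('k^3^3) set) \<noteq> {}"
      by (auto simp: scalar_matrices_def intro: exI[of _ 1])
    fix S T :: "'k^3^3" assume S: "S \<in> scalar_matrices"
    then obtain a where a: "a \<noteq> 0" "S = mat a" by (auto simp: scalar_matrices_def)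
    have "mat (inverse a) \<otimes>\<^bsub>GL3\<^esub> S = \<one>\<^bsub>GL3\<^esub>"
      using a by (simp add: GL3_def mat_mult_mat)
    then have "inv\<^bsub>GL3\<^esub> S = mat (inverse a)"
      using a inv by (intro GL.inv_equality) auto
    then show "inv\<^bsub>GL3\<^esub> S \<in> scalar_matrices"
      using a by (auto simp: scalar_matrices_def)
    assume "T \<in> scalar_matrices"
    then obtain b where b: "b \<noteq> 0" "T = mat b" by (auto simp: scalar_matrices_def)
    show "S \<otimes>\<^bsub>GL3\<^esub> T \<in> scalar_matrices"
      using a b by (auto simp: scalar_matrices_def GL3_def mat_mult_mat)
  qed
  show ?thesis
  proof (rule GL.normalI[OF sub], rule ballI)
    fix A :: "'k^3^3"
    show "scalar_matrices #>\<^bsub>GL3\<^esub> A = A <#\<^bsub>GL3\<^esub> scalar_matrices"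
      by (auto simp: r_coset_def l_coset_def GL3_def scalar_matrices_def mat_mult_commute)
  qed
qed

lemma group_PGL3: "group (PGL3 :: ('k::field^3^3) set monoid)"
  unfolding PGL3_def by (rule normal.factorgroup_is_group[OF scalar_matrices_normal])

end

theory Submission
  imports Defs
begin

text \<open>
  Put \<open>e = d - 1\<close>.  A representative of an automorphism of order \<open>e\<^sup>2\<close> has a scalar power, so in
  characteristic zero it is diagonalizable; let \<open>t\<^sub>i\<close> be its eigenvalues.  Non-singularity at the three
  fixed points forces monomials \<open>X\<^sub>i\<^sup>e X\<^bsub>f i\<^esub>\<close> into the defining form, and all its monomials take the same
  value at \<open>t\<close>.  Since the ratios of the \<open>t\<^sub>i\<close> have order \<open>e\<^sup>2\<close>, only \<open>X\<^sup>d\<close>, \<open>Y\<^sup>e Z\<close>, \<open>X Z\<^sup>e\<close> survive, up to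
  a permutation of the coordinates, and a scaling gives the model.

  Conversely, an automorphism of the model preserves the set of directions along which the Hessian is
  degenerate on a plane.  This makes it diagonal, and comparing coefficients leaves exactly the matrices
  \<open>a diag(1, w, w\<^bsup>-e\<^esup>)\<close> with \<open>w\<close> an \<open>e\<^sup>2\<close>-th root of unity, a cyclic group modulo scalars.  The last claim
  follows because a subgroup containing an element of order \<open>e\<^sup>2\<close> is then the whole cyclic group.
\<close>

section \<open>Evaluation of ternary polynomials\<close>

definition mono_at :: "(3 \<Rightarrow>\<^sub>0 nat) \<Rightarrow> 'k::field^3 \<Rightarrow> 'k" where
  "mono_at m v = (\<Prod>i\<in>UNIV. (v $ i) ^ Poly_Mapping.lookup m i)"

lemma mono_at_0 [simp]: "mono_at 0 v = 1"
  by (simp add: mono_at_def)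

lemma mono_at_add: "mono_at (m + n) v = mono_at m v * mono_at n v"
  by (simp add: mono_at_def lookup_add power_add prod.distrib)

lemma mono_at_3:
  "mono_at m v = v $ 1 ^ Poly_Mapping.lookup m 1 * v $ 2 ^ Poly_Mapping.lookup m 2 * v $ 3 ^ Poly_Mapping.lookup m 3"
  unfolding mono_at_def UNIV_3 by (simp add: mult.assoc)

lemma poly_at_eq: "poly_at F v = (\<Sum>m\<in>Poly_Mapping.keys F. Poly_Mapping.lookup F m * mono_at m v)"
  by (simp add: poly_at_def mono_at_def)

lemma poly_at_eq_superset:
  assumes "finite S" "Poly_Mapping.keys F \<subseteq> S"
  shows "poly_at F v = (\<Sum>m\<in>S. Poly_Mapping.lookup F m * mono_at m v)"
  unfolding poly_at_eq
  by (rule sum.mono_neutral_left) (use assms in \<open>auto simp: in_keys_iff\<close>)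

lemma poly_at_0 [simp]: "poly_at 0 v = 0"
  by (simp add: poly_at_eq)

lemma poly_at_add [simp]: "poly_at (F + G) v = poly_at F v + poly_at G v"
proof -
  let ?S = "Poly_Mapping.keys F \<union> Poly_Mapping.keys G"
  have "poly_at (F + G) v = (\<Sum>m\<in>?S. Poly_Mapping.lookup (F + G) m * mono_at m v)"
    by (rule poly_at_eq_superset) (use keys_add[of F G] in auto)
  also have "\<dots> = (\<Sum>m\<in>?S. Poly_Mapping.lookup F m * mono_at m v)
                + (\<Sum>m\<in>?S. Poly_Mapping.lookup G m * mono_at m v)"
    by (simp add: lookup_add distrib_right sum.distrib)
  also have "\<dots> = poly_at F v + poly_at G v"
    by (simp add: poly_at_eq_superset[symmetric])
  finally show ?thesis .
qed

lemma poly_at_sum [simp]: "poly_at (\<Sum>i\<in>S. f i) v = (\<Sum>i\<in>S. poly_at (f i) v)"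
  by (induction S rule: infinite_finite_induct) auto

lemma poly_at_single [simp]: "poly_at (Poly_Mapping.single m c) v = c * mono_at m v"
  by (cases "c = 0") (auto simp: poly_at_eq)

lemma tpoly_eq_sum_single:
  fixes F :: "'k::field tpoly"
  shows "F = (\<Sum>m\<in>Poly_Mapping.keys F. Poly_Mapping.single m (Poly_Mapping.lookup F m))"
  by (rule poly_mapping_eqI) (auto simp: lookup_sum lookup_single when_def in_keys_iff)

lemma poly_at_mult [simp]: "poly_at (F * G) v = poly_at F v * poly_at G v"
proof -
  let ?f = "\<lambda>F m. Poly_Mapping.single m (Poly_Mapping.lookup F m)"
  have "F * G = (\<Sum>m\<in>Poly_Mapping.keys F. ?f F m) * (\<Sum>n\<in>Poly_Mapping.keys G. ?f G n)"
    using tpoly_eq_sum_single[of F] tpoly_eq_sum_single[of G] by simp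
  also have "poly_at \<dots> v = poly_at F v * poly_at G v"
    by (simp add: sum_product mult_single mono_at_add poly_at_eq[of F] poly_at_eq[of G] mult_ac)
  finally show ?thesis .
qed

lemma poly_at_1 [simp]: "poly_at 1 v = 1"
  by (simp flip: single_one)

lemma poly_at_power [simp]: "poly_at (F ^ n) v = poly_at F v ^ n"
  by (induction n) auto

lemma poly_at_prod [simp]: "poly_at (\<Prod>i\<in>S. f i) v = (\<Prod>i\<in>S. poly_at (f i) v)"
  by (induction S rule: infinite_finite_induct) auto

lemma poly_at_Const [simp]: "poly_at (Const c) v = c"
  by (simp add: Const_def)

lemma poly_at_Var [simp]: "poly_at (Var i) v = v $ i"
proof -
  have "(\<Prod>j\<in>UNIV. v $ j ^ (if i = j then Suc 0 else 0)) = (\<Prod>j\<in>UNIV. if j = i then v $ j else 1)"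
    by (rule prod.cong) auto
  also have "\<dots> = v $ i"
    by (simp add: prod.delta)
  finally show ?thesis
    by (simp add: Var_def mono_at_def lookup_single when_def)
qed

lemma poly_at_lin_subst [simp]: "poly_at (lin_subst A F) v = poly_at F (A *v v)"
  by (simp add: lin_subst_def poly_at_def[of F] matrix_vector_mult_def)

lemma poly_at_model_form:
  "poly_at (model_form d \<alpha>) v = v $ 1 ^ d + v $ 2 ^ (d - 1) * v $ 3 + \<alpha> * v $ 1 * v $ 3 ^ (d - 1)"
  by (simp add: model_form_def)

text \<open>Kronecker substitution \<open>(x, x\<^sup>N, x\<^bsup>N * N\<^esup>)\<close> turns distinct monomials into distinct powers of \<open>x\<close>.\<close>

lemma coeffs_eq_0_if_mono_sum_eq_0:
  fixes a :: "(3 \<Rightarrow>\<^sub>0 nat) \<Rightarrow> 'k::field_char_0"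
  assumes fin: "finite S" and zero: "\<And>v. (\<Sum>m\<in>S. a m * mono_at m v) = 0" and "m0 \<in> S"
  shows "a m0 = 0"
proof -
  \<comment> \<open>The total of all exponents plus one exceeds each single exponent, so exponents
    can serve as digits in base \<open>N\<close>.\<close>
  define N where "N = Suc (\<Sum>m\<in>S. \<Sum>i\<in>UNIV. Poly_Mapping.lookup m i)"
  have bound: "Poly_Mapping.lookup m i < N" if "m \<in> S" for m i
  proof -
    have "Poly_Mapping.lookup m i \<le> (\<Sum>i\<in>UNIV. Poly_Mapping.lookup m i)"
      by (rule member_le_sum) auto
    also have "\<dots> \<le> (\<Sum>m\<in>S. \<Sum>i\<in>UNIV. Poly_Mapping.lookup m i)"
      by (rule member_le_sum[where f = "\<lambda>m. \<Sum>i\<in>UNIV. Poly_Mapping.lookup m i"]) (use that fin in auto)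
    finally show ?thesis by (simp add: N_def)
  qed
  define e where
    "e m = Poly_Mapping.lookup m 1 + N * (Poly_Mapping.lookup m 2 + N * Poly_Mapping.lookup m 3)" for m :: "3 \<Rightarrow>\<^sub>0 nat"
  have e_inj: "m = n" if "m \<in> S" "n \<in> S" "e m = e n" for m n
  proof (rule poly_mapping_eqI)
    have unique: "a = a' \<and> b = b'" if eq: "a + N * b = a' + N * b'" and less: "a < N" "a' < N" for a b a' b' :: nat
    proof -
      have "(a + N * b) mod N = (a' + N * b') mod N" using eq by (rule arg_cong)
      then have "a = a'" using less by simp
      then show ?thesis using eq less by simp
    qed
    have 1: "Poly_Mapping.lookup m 1 = Poly_Mapping.lookup n 1 \<and>
      Poly_Mapping.lookup m 2 + N * Poly_Mapping.lookup m 3 = Poly_Mapping.lookup n 2 + N * Poly_Mapping.lookup n 3"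
      by (rule unique[OF that(3)[unfolded e_def]]) (use that bound in blast)+
    have 2: "Poly_Mapping.lookup m 2 = Poly_Mapping.lookup n 2 \<and> Poly_Mapping.lookup m 3 = Poly_Mapping.lookup n 3"
      by (rule unique[OF conjunct2[OF 1]]) (use that bound in blast)+
    fix i :: 3
    show "Poly_Mapping.lookup m i = Poly_Mapping.lookup n i"
      using 1 2 exhaust_3[of i] by auto
  qed
  define p where "p = (\<Sum>m\<in>S. Polynomial.monom (a m) (e m))"
  have "poly p x = 0" for x
  proof -
    have "mono_at m (vector [x, x ^ N, x ^ (N * N)]) = x ^ e m" for m
      by (simp add: mono_at_3 e_def power_add power_mult distrib_left mult.assoc)
    then show ?thesis
      using zero[of "vector [x, x ^ N, x ^ (N * N)]"] by (simp add: p_def poly_sum poly_monom)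
  qed
  \<comment> \<open>A polynomial vanishing on the whole infinite field is zero; its coefficient at
    \<open>e m0\<close> is \<open>a m0\<close> alone because \<open>e\<close> is injective on
    \<open>S\<close>.\<close>
  then have "p = 0"
    using poly_all_0_iff_0 by blast
  then have "0 = poly.coeff p (e m0)" by simp
  also have "\<dots> = (\<Sum>m\<in>S. if m = m0 then a m else 0)"
    unfolding p_def coeff_sum by (rule sum.cong) (use e_inj \<open>m0 \<in> S\<close> in auto)
  also have "\<dots> = a m0" using \<open>m0 \<in> S\<close> fin by simp
  finally show ?thesis by simp
qed

text \<open>Characteristic zero makes the field infinite, so a polynomial is determined by its
  values. Identities of forms can therefore be checked pointwise from here on.\<close>

lemma poly_at_inject:
  fixes F G :: "'k::field_char_0 tpoly"
  assumes "\<And>v. poly_at F v = poly_at G v"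
  shows "F = G"
proof (rule poly_mapping_eqI)
  fix m
  let ?S = "insert m (Poly_Mapping.keys F \<union> Poly_Mapping.keys G)"
  have "(\<Sum>m\<in>?S. (Poly_Mapping.lookup F m - Poly_Mapping.lookup G m) * mono_at m v) = 0" for v
  proof -
    have "poly_at F v = (\<Sum>m\<in>?S. Poly_Mapping.lookup F m * mono_at m v)"
      "poly_at G v = (\<Sum>m\<in>?S. Poly_Mapping.lookup G m * mono_at m v)"
      by (rule poly_at_eq_superset; auto)+
    then show ?thesis using assms[of v] by (simp only: left_diff_distrib sum_subtractf) simp
  qed
  from coeffs_eq_0_if_mono_sum_eq_0[OF _ this, of m]
  show "Poly_Mapping.lookup F m = Poly_Mapping.lookup G m" by simp
qed

section \<open>Linear substitution: degree, chain rule and non-singularity\<close>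

lemma lin_subst_eq_Const_mult_iff:
  fixes F G :: "'k::field_char_0 tpoly"
  shows "lin_subst A F = Const c * G \<longleftrightarrow> (\<forall>v. poly_at F (A *v v) = c * poly_at G v)"
  by (metis poly_at_inject poly_at_Const poly_at_lin_subst poly_at_mult)

text \<open>Scaling the argument by 2 multiplies a monomial of degree \<open>k\<close> by
  \<open>2 ^ k\<close>. Coefficient comparison forces \<open>2 ^ k = 2 ^ d\<close>, hence
  \<open>k = d\<close> in characteristic zero.\<close>

lemma homogeneous_lin_subst:
  fixes F :: "'k::field_char_0 tpoly"
  assumes "homogeneous d F"
  shows "homogeneous d (lin_subst A F)"
  unfolding homogeneous_def
proof
  fix m assume m: "m \<in> Poly_Mapping.keys (lin_subst A F)"
  let ?G = "lin_subst A F" and ?deg = "\<lambda>m::3 \<Rightarrow>\<^sub>0 nat. \<Sum>i\<in>UNIV. Poly_Mapping.lookup m i"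
  have scale: "mono_at m (2 *s v) = 2 ^ ?deg m * mono_at m v" for m and v :: "'k^3"
    by (simp add: mono_at_def power_mult_distrib prod.distrib power_sum)
  have F2: "poly_at F (2 *s v) = 2 ^ d * poly_at F v" for v
    using assms by (simp add: poly_at_eq scale homogeneous_def sum_distrib_left mult_ac)
  have "(\<Sum>m\<in>Poly_Mapping.keys ?G. (Poly_Mapping.lookup ?G m * (2 ^ ?deg m - 2 ^ d)) * mono_at m v) = 0" for v
  proof -
    have "poly_at ?G (2 *s v) = 2 ^ d * poly_at ?G v"
      using F2[of "A *v v"] by (simp add: vector_scalar_commute)
    then show ?thesis
      unfolding poly_at_eq scale
      by (simp add: sum_distrib_left algebra_simps sum_subtractf)
  qed
  from coeffs_eq_0_if_mono_sum_eq_0[OF _ this m]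
  have "(2::'k) ^ ?deg m = 2 ^ d" using m by (simp add: in_keys_iff)
  then have "of_nat (2 ^ ?deg m) = (of_nat (2 ^ d) :: 'k)" by simp
  then have "(2::nat) ^ ?deg m = 2 ^ d" by (simp only: of_nat_eq_iff)
  then show "?deg m = d" by simp
qed

text \<open>The first Taylor coefficient, phrased with univariate polynomials because there is no topology on the field.\<close>

lemma poly_at_line:
  fixes F :: "'k::field tpoly" and p w :: "'k^3"
  shows "\<exists>q. (\<forall>t. poly q t = poly_at F (p + t *s w)) \<and>
    poly.coeff q 1 = (\<Sum>i\<in>UNIV. poly_at (partial_deriv i F) p * w $ i)"
proof (intro exI conjI allI)
  define l where "l i = [:p $ i, w $ i:]" for i
  define q where "q = (\<Sum>m\<in>Poly_Mapping.keys F. Polynomial.smult (Poly_Mapping.lookup F m) (\<Prod>i\<in>UNIV. l i ^ Poly_Mapping.lookup m i))"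
  show "poly q t = poly_at F (p + t *s w)" for t :: 'k
    by (simp add: q_def l_def poly_sum poly_prod poly_at_def)
  \<comment> \<open>If the exponent of \<open>i\<close> is 0, both truncated subtractions give
    exponent 0; the factor \<open>of_nat 0\<close> then removes the term, as differentiation
    should.\<close>
  have mono_deriv: "mono_at (m - Poly_Mapping.single i 1) p * of_nat (Poly_Mapping.lookup m i)
      = of_nat (Poly_Mapping.lookup m i) * p $ i ^ (Poly_Mapping.lookup m i - 1)
        * (\<Prod>j\<in>UNIV - {i}. p $ j ^ Poly_Mapping.lookup m j)" for m :: "3 \<Rightarrow>\<^sub>0 nat" and i
  proof -
    have "mono_at (m - Poly_Mapping.single i 1) p
       = p $ i ^ (Poly_Mapping.lookup m i - 1) * (\<Prod>j\<in>UNIV - {i}. p $ j ^ Poly_Mapping.lookup m j)"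
      unfolding mono_at_def
      by (subst prod.remove[of _ i]) (auto simp: lookup_minus lookup_single when_def intro!: prod.cong)
    then show ?thesis by simp
  qed
  have "poly.coeff (\<Prod>i\<in>UNIV. l i ^ Poly_Mapping.lookup m i) 1
      = (\<Sum>i\<in>UNIV. mono_at (m - Poly_Mapping.single i 1) p * of_nat (Poly_Mapping.lookup m i) * w $ i)"
    for m :: "3 \<Rightarrow>\<^sub>0 nat"
  proof -
    have "poly.coeff (\<Prod>i\<in>UNIV. l i ^ Poly_Mapping.lookup m i) 1
        = poly (pderiv (\<Prod>i\<in>UNIV. l i ^ Poly_Mapping.lookup m i)) 0"
      by (simp add: poly_0_coeff_0 coeff_pderiv)
    also have "\<dots> = (\<Sum>i\<in>UNIV. (\<Prod>j\<in>UNIV - {i}. p $ j ^ Poly_Mapping.lookup m j)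
        * (of_nat (Poly_Mapping.lookup m i) * p $ i ^ (Poly_Mapping.lookup m i - 1) * w $ i))"
      by (simp add: pderiv_prod poly_sum poly_prod pderiv_power l_def pderiv_pCons mult_ac)
    finally show ?thesis unfolding mono_deriv by (simp only: mult_ac)
  qed
  then have "poly.coeff q 1 = (\<Sum>m\<in>Poly_Mapping.keys F. \<Sum>i\<in>UNIV. Poly_Mapping.lookup F m *
     (mono_at (m - Poly_Mapping.single i 1) p * of_nat (Poly_Mapping.lookup m i) * w $ i))"
    by (simp add: q_def coeff_sum sum_distrib_left)
  also have "\<dots> = (\<Sum>i\<in>UNIV. poly_at (partial_deriv i F) p * w $ i)"
    by (subst sum.swap) (simp add: partial_deriv_def sum_distrib_left mult_ac)
  finally show "poly.coeff q 1 = (\<Sum>i\<in>UNIV. poly_at (partial_deriv i F) p * w $ i)" .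
qed

text \<open>Chain rule: the values of \<open>F\<close> on the image under \<open>A\<close> of the
  line \<open>p + t *s w\<close> form one univariate polynomial, whose linear coefficient is
  computed in two ways.\<close>

lemma partial_deriv_lin_subst:
  fixes F :: "'k::field_char_0 tpoly"
  shows "(\<Sum>i\<in>UNIV. poly_at (partial_deriv i (lin_subst A F)) p * w $ i)
       = (\<Sum>i\<in>UNIV. poly_at (partial_deriv i F) (A *v p) * (A *v w) $ i)"
proof -
  obtain q where q: "\<And>t. poly q t = poly_at (lin_subst A F) (p + t *s w)"
    "poly.coeff q 1 = (\<Sum>i\<in>UNIV. poly_at (partial_deriv i (lin_subst A F)) p * w $ i)"
    using poly_at_line[where F = "lin_subst A F" and p = p and w = w] by blast
  obtain r where r: "\<And>t. poly r t = poly_at F (A *v p + t *s (A *v w))"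
    "poly.coeff r 1 = (\<Sum>i\<in>UNIV. poly_at (partial_deriv i F) (A *v p) * (A *v w) $ i)"
    using poly_at_line[where F = F and p = "A *v p" and w = "A *v w"] by blast
  have "poly q t = poly r t" for t
    by (simp add: q(1) r(1) matrix_vector_right_distrib vector_scalar_commute)
  then have "poly q = poly r" by (rule ext)
  then have "q = r" by (simp only: poly_eq_poly_eq_iff)
  then show ?thesis using q(2) r(2) by simp
qed

lemma nonsingular_lin_subst:
  fixes F :: "'k::field_char_0 tpoly"
  assumes ns: "nonsingular_plane_curve d F" and A: "invertible A"
  shows "nonsingular_plane_curve d (lin_subst A F)"
proof -
  obtain B where B: "A ** B = mat 1" "B ** A = mat 1" using A by (auto simp: invertible_def)
  have AB: "A *v (B *v v) = v" "B *v (A *v v) = v" for v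
    by (simp_all add: matrix_vector_mul_assoc B)
  have "lin_subst A F \<noteq> 0"
  proof
    assume "lin_subst A F = 0"
    then have "poly_at F v = poly_at 0 v" for v
      using poly_at_lin_subst[of A F "B *v v"] by (simp add: AB)
    then have "F = 0" by (rule poly_at_inject)
    then show False using ns by (simp add: nonsingular_plane_curve_def)
  qed
  moreover have "\<exists>i. poly_at (partial_deriv i (lin_subst A F)) p \<noteq> 0"
    if p: "p \<noteq> 0" "poly_at (lin_subst A F) p = 0" for p
  proof (rule ccontr)
    assume zero: "\<not> ?thesis"
    have "A *v p \<noteq> 0" using p(1) AB(2)[of p] by auto
    then obtain i where i: "poly_at (partial_deriv i F) (A *v p) \<noteq> 0"
      using ns p(2) by (auto simp: nonsingular_plane_curve_def)
    \<comment> \<open>The direction \<open>B *v axis i 1\<close> is the one that \<open>A\<close>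
      maps to the \<open>i\<close>-th axis, so the chain rule isolates the \<open>i\<close>-th
      partial derivative of \<open>F\<close>.\<close>
    have "0 = (\<Sum>j\<in>UNIV. poly_at (partial_deriv j F) (A *v p) * (A *v (B *v axis i 1)) $ j)"
      using partial_deriv_lin_subst[of A F p "B *v axis i 1"] zero by simp
    also have "\<dots> = poly_at (partial_deriv i F) (A *v p)"
      by (simp add: AB axis_def if_distrib[of "(*) _"] cong: if_cong)
    finally show False using i by simp
  qed
  ultimately show ?thesis
    using ns homogeneous_lin_subst by (auto simp: nonsingular_plane_curve_def)
qed

section \<open>Roots of unity and diagonalization\<close>

lemma power_gcd_eq_1:
  fixes a :: "'a::field"
  assumes "a ^ k = 1" "a ^ l = 1"
  shows "a ^ gcd k l = 1"
proof (cases "k = 0")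
  case False
  then obtain x y where xy: "k * x = l * y + gcd k l" using bezout_nat by blast
  have "1 = a ^ (k * x)" by (simp add: power_mult assms)
  also have "\<dots> = a ^ gcd k l" by (simp add: xy power_add power_mult assms)
  finally show ?thesis by simp
qed (use assms in simp)

text \<open>Any root of \<open>1 + x + ... + x ^ (p - 1)\<close> works: it is a root of
  \<open>x ^ p - 1\<close>, and it is not 1 because the sum at 1 is \<open>p\<close>, non-zero in
  characteristic zero.\<close>

lemma exists_nontrivial_root_of_unity:
  assumes "p > 1"
  shows "\<exists>x::'k::{alg_closed_field, field_char_0}. x ^ p = 1 \<and> x \<noteq> 1"
proof -
  obtain x :: 'k where "(\<Sum>k\<le>p - 1. 1 * x ^ k) = 0"
    using alg_closed[of "p - 1" "\<lambda>_. 1::'k"] assms by auto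
  moreover have "{..p - 1} = {..<p}" using assms by auto
  ultimately have x: "(\<Sum>k<p. x ^ k) = 0" by simp
  have "x ^ p - 1 = 0" by (simp only: power_diff_1_eq x mult_zero_right)
  moreover have "x \<noteq> 1" using x assms by auto
  ultimately show ?thesis by auto
qed

text \<open>Induction along \<open>n = p * m\<close> with \<open>p\<close> prime, taking a
  \<open>p\<close>-th root of a primitive \<open>m\<close>-th root \<omega>. Two such roots,
  differing by a non-trivial \<open>p\<close>-th root of unity, are considered because one of them
  may still have order dividing \<open>m\<close>.\<close>

lemma exists_primitive_root_of_unity:
  assumes "n > 0"
  shows "\<exists>\<zeta>::'k::{alg_closed_field, field_char_0}. \<forall>k. \<zeta> ^ k = 1 \<longleftrightarrow> n dvd k"
  using assms
proof (induction n rule: less_induct)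
  case (less n)
  show ?case
  proof (cases "n = 1")
    case True
    then show ?thesis by (intro exI[of _ 1]) auto
  next
    case False
    then obtain p m where p: "Factorial_Ring.prime p" and n: "n = p * m"
      using prime_factor_nat[of n] by (auto simp: dvd_def)
    have "m > 0" "m < n" using less.prems n prime_gt_1_nat[OF p] by auto
    then obtain \<omega> :: 'k where \<omega>: "\<omega> ^ k = 1 \<longleftrightarrow> m dvd k" for k
      using less.IH by blast
    \<comment> \<open>\<open>\<omega> = z ^ p\<close> already forces \<open>m dvd k\<close>, say
      \<open>k = m * j\<close>; if \<open>p\<close> did not divide \<open>j\<close>, the gcd of
      \<open>k\<close> and \<open>n\<close> would be \<open>m\<close>, contradicting
      \<open>z ^ m \<noteq> 1\<close>.\<close>
    have prim: "z ^ k = 1 \<longleftrightarrow> n dvd k" if z: "z ^ p = \<omega>" "z ^ m \<noteq> 1" for z k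
    proof -
      have zn: "z ^ n = 1" by (simp add: n power_mult z \<omega>)
      show ?thesis
      proof
        assume k: "z ^ k = 1"
        have "\<omega> ^ k = (z ^ k) ^ p" by (simp add: mult.commute flip: z(1) power_mult)
        then have "m dvd k" using k \<omega> by simp
        then obtain j where j: "k = m * j" by (auto simp: dvd_def)
        have "z ^ gcd k n = 1" by (rule power_gcd_eq_1[OF k zn])
        moreover have "gcd k n = m * gcd j p" by (simp add: j n mult.commute[of p] gcd_mult_distrib_nat)
        ultimately have "gcd j p \<noteq> 1" using z by auto
        then have "p dvd j" using p by (metis coprime_commute coprime_iff_gcd_eq_1 prime_imp_coprime)
        then show "n dvd k" by (auto simp: n j)
      next
        assume "n dvd k"
        then show "z ^ k = 1" by (auto simp: power_mult zn dvd_def)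
      qed
    qed
    obtain z where z: "z ^ p = \<omega>"
      using nth_root_exists[of p \<omega>] prime_gt_0_nat[OF p] by blast
    obtain \<eta> :: 'k where \<eta>: "\<eta> ^ p = 1" "\<eta> \<noteq> 1"
      using exists_nontrivial_root_of_unity prime_gt_1_nat[OF p] by blast
    \<comment> \<open>If both powers were 1, then \<open>\<eta> ^ m = 1\<close> would give
      \<open>p dvd m\<close>, and with \<open>m = p * l\<close> also
      \<open>\<omega> ^ l = z ^ m = 1\<close>, where \<open>0 < l < m\<close>.\<close>
    have "z ^ m \<noteq> 1 \<or> (z * \<eta>) ^ m \<noteq> 1"
    proof (rule ccontr)
      assume "\<not> ?thesis"
      then have zm: "z ^ m = 1" and "\<eta> ^ m = 1" by (auto simp: power_mult_distrib)
      then have "\<eta> ^ gcd m p = 1" using \<eta> by (intro power_gcd_eq_1)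
      then have "gcd m p \<noteq> 1" using \<eta> by auto
      then have "p dvd m" using p by (metis coprime_commute coprime_iff_gcd_eq_1 prime_imp_coprime)
      then obtain l where l: "m = p * l" by (auto simp: dvd_def)
      then have "\<omega> ^ l = 1" using zm by (simp add: power_mult flip: z)
      then have "m \<le> l" using \<omega> \<open>m > 0\<close> l by (auto intro: dvd_imp_le)
      then show False using l \<open>m > 0\<close> prime_gt_1_nat[OF p] by auto
    qed
    moreover have "(z * \<eta>) ^ p = \<omega>" by (simp add: power_mult_distrib z \<eta>)
    ultimately show ?thesis using prim z by blast
  qed
qed

text \<open>The first \<open>n\<close> powers of \<zeta> are distinct roots of
  \<open>x ^ n - 1\<close>, whose degree leaves room for no others.\<close>

lemma root_of_unity_eq_power:
  fixes \<zeta> x :: "'k::field_char_0"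
  assumes \<zeta>: "\<And>k. \<zeta> ^ k = 1 \<longleftrightarrow> n dvd k" and "n > 0" and x: "x ^ n = 1"
  shows "\<exists>k<n. x = \<zeta> ^ k"
proof -
  have [simp]: "\<zeta> \<noteq> 0" using \<zeta>[of n] \<open>n > 0\<close> by (auto simp: power_0_left)
  have inj: "inj_on (\<lambda>k. \<zeta> ^ k) {..<n}"
  proof (rule linorder_inj_onI)
    fix i j assume ij: "i < j" "i \<in> {..<n}" "j \<in> {..<n}"
    have "\<zeta> ^ (j - i) \<noteq> 1" using \<zeta>[of "j - i"] ij by (auto dest: dvd_imp_le)
    then show "\<zeta> ^ i \<noteq> \<zeta> ^ j"
      using ij by (auto simp: power_diff)
  qed auto
  define p where "p = (Polynomial.monom 1 n - 1 :: 'k poly)"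
  have "poly.coeff p n = 1" using \<open>n > 0\<close> by (simp add: p_def)
  then have "p \<noteq> 0" by auto
  have deg: "Polynomial.degree p \<le> n" unfolding p_def by (rule degree_diff_le) (auto simp: degree_monom_le)
  have roots: "{x. poly p x = 0} = {x. x ^ n = 1}" by (auto simp: p_def poly_monom)
  have "(\<lambda>k. \<zeta> ^ k) ` {..<n} = {x. x ^ n = 1}"
  proof (rule card_seteq)
    show "finite {x::'k. x ^ n = 1}" using poly_roots_finite[OF \<open>p \<noteq> 0\<close>] roots by simp
    show "(\<lambda>k. \<zeta> ^ k) ` {..<n} \<subseteq> {x. x ^ n = 1}"
      by (auto simp: \<zeta> simp flip: power_mult)
    show "card {x::'k. x ^ n = 1} \<le> card ((\<lambda>k. \<zeta> ^ k) ` {..<n})"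
      using card_poly_roots_bound[OF \<open>p \<noteq> 0\<close>] deg roots inj by (simp add: card_image)
  qed
  then show ?thesis using x by auto
qed

text \<open>Averaging over the cyclic group generated by \<open>A\<close> splits each vector into
  eigenvectors. These therefore span the space, and a basis can be chosen among them.\<close>

lemma finite_order_diagonalizable:
  fixes A :: "'k::{alg_closed_field, field_char_0}^'n^'n"
  assumes per: "\<And>v. ((*v) A ^^ N) v = v" and "N > 0"
  obtains P :: "'k^'n^'n" and t where "invertible P" and "\<And>i. A *v column i P = t i *s column i P"
proof -
  obtain \<zeta> :: 'k where \<zeta>: "\<zeta> ^ k = 1 \<longleftrightarrow> N dvd k" for k
    using exists_primitive_root_of_unity[OF \<open>N > 0\<close>] by blast
  have "\<zeta> ^ N = 1" using \<zeta> by simp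
  then have \<zeta>0: "\<zeta> \<noteq> 0" using \<open>N > 0\<close> by (auto simp: power_0_left)
  define S where "S = {v. \<exists>t. A *v v = t *s v}"
  \<comment> \<open>\<open>E l\<close> is \<open>N\<close> times the projection onto the eigenspace
    for \<open>\<zeta> ^ l\<close>, a discrete Fourier transform of the orbit of
    \<open>v\<close>.\<close>
  define E where "E l v = (\<Sum>k<N. inverse (\<zeta> ^ l) ^ k *s ((*v) A ^^ k) v)" for l v
  have E: "E l v \<in> S" for l v
  proof -
    let ?w = "\<zeta> ^ l"
    define h where "h k = inverse ?w ^ k *s ((*v) A ^^ k) v" for k
    have "?w ^ N = 1" using \<open>\<zeta> ^ N = 1\<close> by (metis mult.commute power_mult power_one)
    then have hN: "h N = h 0" by (simp add: h_def per power_inverse)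
    have step: "A *v h k = ?w *s h (Suc k)" for k
      by (simp add: h_def vector_scalar_commute vector_smult_assoc \<zeta>0)
    have "A *v E l v = (\<Sum>k<N. A *v h k)"
      unfolding E_def h_def by (rule vec.linear_sum[OF matrix_vector_mul_linear_gen])
    also have "\<dots> = ?w *s (\<Sum>k<N. h (Suc k))"
      by (simp add: step vec.scale_sum_right)
    \<comment> \<open>Since \<open>h N = h 0\<close>, shifting the index leaves the cyclic sum
      unchanged.\<close>
    also have "(\<Sum>k<N. h (Suc k)) = (\<Sum>k<N. h k)"
      using sum.lessThan_Suc_shift[of h N] sum.lessThan_Suc[of h N] hN by simp
    also have "\<dots> = E l v" by (simp add: E_def h_def)
    finally show ?thesis by (auto simp: S_def)
  qed
  \<comment> \<open>Orthogonality of characters: it makes the vectors \<open>E l v\<close> add up to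
    \<open>N\<close> times \<open>v\<close>.\<close>
  have char_sum: "(\<Sum>l<N. inverse (\<zeta> ^ l) ^ k) = (if k = 0 then of_nat N else 0)" if "k < N" for k
  proof (cases "k = 0")
    case False
    let ?x = "inverse \<zeta> ^ k"
    have eq: "inverse (\<zeta> ^ l) ^ k = ?x ^ l" for l
      by (simp add: mult.commute flip: power_mult power_inverse)
    have "?x \<noteq> 1" using \<zeta>[of k] that False by (auto simp: power_inverse dest: dvd_imp_le)
    moreover have "?x ^ N = 1"
      using \<zeta>[of "k * N"] by (simp add: power_inverse flip: power_mult)
    moreover have "?x ^ N - 1 = (?x - 1) * (\<Sum>l<N. ?x ^ l)"
      by (rule power_diff_1_eq)
    ultimately show ?thesis using False unfolding eq by simp
  qed simp
  have "vec.span S = UNIV"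
  proof -
    have "v \<in> vec.span S" for v
    proof -
      have "(\<Sum>l<N. E l v) = (\<Sum>k<N. (\<Sum>l<N. inverse (\<zeta> ^ l) ^ k) *s ((*v) A ^^ k) v)"
        unfolding E_def by (subst sum.swap) (simp add: vec.scale_sum_left)
      also have "\<dots> = (\<Sum>k<N. if k = 0 then of_nat N *s v else 0)"
        by (rule sum.cong) (auto simp: char_sum)
      also have "\<dots> = of_nat N *s v" using \<open>N > 0\<close> by simp
      finally have "v = inverse (of_nat N) *s (\<Sum>l<N. E l v)"
        using \<open>N > 0\<close> by (simp add: vector_smult_assoc)
      moreover have "(\<Sum>l<N. E l v) \<in> vec.span S"
        by (intro vec.span_sum vec.span_base E)
      ultimately show ?thesis using vec.span_scale by metis
    qed
    then show ?thesis by auto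
  qed
  moreover obtain B where B: "B \<subseteq> S" "vec.independent B" "S \<subseteq> vec.span B"
    using vec.maximal_independent_subset[of S] by blast
  ultimately have span: "vec.span B = UNIV"
    using vec.span_mono[OF B(3)] by (auto simp: vec.span_span)
  have "finite B" using B(2) vec.finiteI_independent by blast
  have "card B = CARD('n)"
    using vec.dim_eq_card_independent[OF B(2)] vec.dim_span[of B] span vec_dim_card by metis
  then obtain b where b: "bij_betw b (UNIV :: 'n set) B"
    using finite_same_card_bij[of "UNIV :: 'n set" B] \<open>finite B\<close> by auto
  define P :: "'k^'n^'n" where "P = (\<chi> i j. b j $ i)"
  have col: "column j P = b j" for j by (simp add: column_def P_def vec_eq_iff)
  have "columns P = B" using b by (auto simp: columns_def col bij_betw_def)
  then have "\<exists>Q. P ** Q = mat 1" using span by (simp add: matrix_right_invertible_span_columns)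
  then have "invertible P" by (simp add: invertible_right_inverse)
  moreover have "\<exists>t. A *v column i P = t *s column i P" for i
    using b B(1) by (auto simp: col S_def bij_betw_def)
  then obtain t where "\<And>i. A *v column i P = t i *s column i P" by metis
  ultimately show thesis by (rule that)
qed

section \<open>Automorphisms as matrix classes\<close>

abbreviation pgl_class :: "'k::field^3^3 \<Rightarrow> ('k^3^3) set" where
  "pgl_class A \<equiv> scalar_matrices #>\<^bsub>GL3\<^esub> A"

lemma mat_mult_vec: "mat c *v v = c *s (v :: 'k::field^'n)"
  by (simp add: vec_eq_iff matrix_vector_mult_def mat_def if_distrib[where f = "\<lambda>x. x * _"] cong: if_cong)

lemma mat_mult_vec_assoc: "(mat c ** A) *v v = c *s (A *v (v :: 'k::field^'n))"
  by (simp add: mat_mult_vec flip: matrix_vector_mul_assoc)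

lemma matrix_eq_iff: "A = B \<longleftrightarrow> (\<forall>v. A *v v = B *v (v :: 'k::field^'n))"
  by (metis matrix_of_matrix_vector_mul ext)

lemma mem_pgl_class: "B \<in> pgl_class A \<longleftrightarrow> (\<exists>c. c \<noteq> 0 \<and> B = mat c ** A)"
  by (auto simp: r_coset_def scalar_matrices_def GL3_def)

lemma carrier_GL3 [simp]: "A \<in> carrier GL3 \<longleftrightarrow> invertible A"
  by (simp add: GL3_def)

lemma mult_GL3 [simp]: "A \<otimes>\<^bsub>GL3\<^esub> B = A ** B"
  by (simp add: GL3_def)

lemma one_GL3 [simp]: "\<one>\<^bsub>GL3\<^esub> = mat 1"
  by (simp add: GL3_def)

lemma carrier_PGL3: "carrier PGL3 = pgl_class ` {A. invertible A}"
  by (auto simp: PGL3_def carrier_FactGroup)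

lemma pgl_class_mult:
  "invertible A \<Longrightarrow> invertible B \<Longrightarrow> pgl_class A \<otimes>\<^bsub>PGL3\<^esub> pgl_class B = pgl_class (A ** B)"
  using normal.rcos_sum[OF scalar_matrices_normal, of A B] by (simp add: PGL3_def)

lemma one_PGL3: "\<one>\<^bsub>PGL3\<^esub> = scalar_matrices"
  by (simp add: PGL3_def)

lemma pgl_class_eq_one_iff:
  fixes A :: "'k::field^3^3"
  assumes "invertible A"
  shows "pgl_class A = \<one>\<^bsub>PGL3\<^esub> \<longleftrightarrow> (\<exists>c. \<forall>v. A *v v = c *s v)"
proof -
  interpret GL: group "GL3 :: ('k^3^3) monoid" by (rule group_GL3)
  have sub: "subgroup scalar_matrices (GL3 :: ('k^3^3) monoid)"
    using scalar_matrices_normal by (rule normal_imp_subgroup)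
  have "pgl_class A = \<one>\<^bsub>PGL3\<^esub> \<longleftrightarrow> A \<in> scalar_matrices"
    using assms GL.coset_join1[OF _ _ sub] GL.coset_join2[OF _ sub] subgroup.subset[OF sub]
    unfolding one_PGL3 by auto
  also have "\<dots> \<longleftrightarrow> (\<exists>c. \<forall>v. A *v v = c *s v)"
  proof
    assume "\<exists>c. \<forall>v. A *v v = c *s v"
    then obtain c where c: "\<And>v. A *v v = c *s v" by blast
    then have A: "A = mat c" by (simp add: matrix_eq_iff mat_mult_vec)
    have "c \<noteq> 0"
    proof
      assume "c = 0"
      then have "A *v axis 1 1 = A *v 0" by (simp add: c)
      then show False
        using assms by (metis axis_eq_0_iff invertible_def matrix_vector_mul_assoc matrix_vector_mul_lid zero_neq_one)
    qed
    then show "A \<in> scalar_matrices" using A by (auto simp: scalar_matrices_def)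
  qed (auto simp: scalar_matrices_def mat_mult_vec)
  finally show ?thesis .
qed

lemma pgl_class_pow:
  fixes A :: "'k::field^3^3"
  assumes "invertible A"
  shows "pgl_class A [^]\<^bsub>PGL3\<^esub> (n::nat) = pgl_class (A [^]\<^bsub>GL3\<^esub> n)"
  using normal.FactGroup_pow[OF scalar_matrices_normal, of A n] assms by (simp add: PGL3_def)

lemma GL3_pow_mult_vec:
  fixes A :: "'k::field^3^3"
  shows "(A [^]\<^bsub>GL3\<^esub> (n::nat)) *v v = ((*v) A ^^ n) v"
proof (induction n arbitrary: v)
  case (Suc n)
  have "(A [^]\<^bsub>GL3\<^esub> Suc n) *v v = (A [^]\<^bsub>GL3\<^esub> n) *v (A *v v)"
    by (simp add: matrix_vector_mul_assoc)
  then show ?case by (simp add: Suc.IH funpow_swap1)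
qed simp

lemma pgl_class_pow_eq_one_iff:
  fixes A :: "'k::field^3^3"
  assumes "invertible A"
  shows "pgl_class A [^]\<^bsub>PGL3\<^esub> (n::nat) = \<one>\<^bsub>PGL3\<^esub> \<longleftrightarrow> (\<exists>c. \<forall>v. ((*v) A ^^ n) v = c *s v)"
proof -
  interpret GL: group "GL3 :: ('k^3^3) monoid" by (rule group_GL3)
  have "invertible (A [^]\<^bsub>GL3\<^esub> n)" using GL.nat_pow_closed[of A n] assms by simp
  then show ?thesis
    by (simp only: pgl_class_pow[OF assms] pgl_class_eq_one_iff GL3_pow_mult_vec)
qed

text \<open>\<open>Aut\<close> asks for some element of the class that preserves \<open>F\<close> up
  to a factor; every element of a coset represents it, so this element can serve as the matrix
  naming the class.\<close>

lemma carrier_Aut_iff: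
  fixes F :: "'k::field_char_0 tpoly"
  shows "T \<in> carrier (Aut F) \<longleftrightarrow> (\<exists>A c. T = pgl_class A \<and> invertible A \<and> c \<noteq> 0 \<and>
    (\<forall>v. poly_at F (A *v v) = c * poly_at F v))"
proof
  interpret GL: group "GL3 :: ('k^3^3) monoid" by (rule group_GL3)
  have sub: "subgroup scalar_matrices (GL3 :: ('k^3^3) monoid)"
    using scalar_matrices_normal by (rule normal_imp_subgroup)
  {
    assume "T \<in> carrier (Aut F)"
    then obtain A B c where T: "T = pgl_class B" "invertible B" "A \<in> T" and c: "c \<noteq> 0"
      "\<forall>v. poly_at F (A *v v) = c * poly_at F v"
      by (auto simp: Aut_def carrier_PGL3 lin_subst_eq_Const_mult_iff)
    have "A \<in> carrier GL3"
      using T GL.r_coset_subset_G[OF subgroup.subset[OF sub], of B] by auto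
    moreover have "T = pgl_class A"
      using T GL.repr_independence[OF _ _ sub, of A B] by auto
    ultimately show "\<exists>A c. T = pgl_class A \<and> invertible A \<and> c \<noteq> 0 \<and>
        (\<forall>v. poly_at F (A *v v) = c * poly_at F v)"
      using c by auto
  next
    assume "\<exists>A c. T = pgl_class A \<and> invertible A \<and> c \<noteq> 0 \<and>
        (\<forall>v. poly_at F (A *v v) = c * poly_at F v)"
    then obtain A c where *: "T = pgl_class A" "invertible A" "c \<noteq> 0"
      "\<forall>v. poly_at F (A *v v) = c * poly_at F v" by blast
    moreover have "A \<in> pgl_class A" using GL.rcos_self[OF _ sub, of A] * by simp
    ultimately show "T \<in> carrier (Aut F)"
      by (auto simp: Aut_def carrier_PGL3 lin_subst_eq_Const_mult_iff)
  }
qed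

lemma Aut_eq: "Aut F = PGL3\<lparr>carrier := carrier (Aut F)\<rparr>"
  by (simp add: Aut_def)

lemma subgroup_Aut:
  fixes F :: "'k::field_char_0 tpoly"
  shows "subgroup (carrier (Aut F)) PGL3"
proof -
  interpret PGL: group "PGL3 :: ('k^3^3) set monoid" by (rule group_PGL3)
  show ?thesis
  proof (rule PGL.subgroupI)
    show "carrier (Aut F) \<subseteq> carrier PGL3" by (auto simp: Aut_def)
    have "pgl_class (mat 1) \<in> carrier (Aut F)"
      unfolding carrier_Aut_iff by (intro exI[of _ "mat 1"] exI[of _ 1]) (auto simp: invertible_def intro!: exI[of _ "mat 1"])
    then show "carrier (Aut F) \<noteq> {}" by blast
  next
    fix T assume "T \<in> carrier (Aut F)"
    then obtain A c where A: "T = pgl_class A" "invertible A" "c \<noteq> 0"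
      "\<And>v. poly_at F (A *v v) = c * poly_at F v" by (auto simp: carrier_Aut_iff)
    obtain B where B: "A ** B = mat 1" "B ** A = mat 1" using A(2) by (auto simp: invertible_def)
    then have invB: "invertible B" by (auto simp: invertible_def)
    have "pgl_class B \<otimes>\<^bsub>PGL3\<^esub> T = pgl_class (mat 1)"
      by (simp add: A(1) pgl_class_mult[OF invB A(2)] B)
    also have "\<dots> = \<one>\<^bsub>PGL3\<^esub>"
      by (subst pgl_class_eq_one_iff) (auto simp: invertible_def mat_mult_vec intro!: exI[of _ "mat 1"] exI[of _ 1])
    finally have "inv\<^bsub>PGL3\<^esub> T = pgl_class B"
      using A(1,2) invB by (intro PGL.inv_equality) (auto simp: carrier_PGL3)
    moreover have "poly_at F (B *v v) = inverse c * poly_at F v" for v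
      using A(4)[of "B *v v"] A(3) by (simp add: matrix_vector_mul_assoc B)
    ultimately show "inv\<^bsub>PGL3\<^esub> T \<in> carrier (Aut F)"
      using invB A(3) unfolding carrier_Aut_iff by (intro exI[of _ B] exI[of _ "inverse c"]) auto
  next
    fix S T assume "S \<in> carrier (Aut F)" "T \<in> carrier (Aut F)"
    then obtain A c B b where A: "S = pgl_class A" "invertible A" "c \<noteq> 0"
      "\<And>v. poly_at F (A *v v) = c * poly_at F v" and
      B: "T = pgl_class B" "invertible B" "b \<noteq> 0"
      "\<And>v. poly_at F (B *v v) = b * poly_at F v" by (auto simp: carrier_Aut_iff)
    show "S \<otimes>\<^bsub>PGL3\<^esub> T \<in> carrier (Aut F)"
      unfolding carrier_Aut_iff
      by (intro exI[of _ "A ** B"] exI[of _ "c * b"])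
        (auto simp: A B pgl_class_mult invertible_mult simp flip: matrix_vector_mul_assoc)
  qed
qed

lemma group_Aut:
  fixes F :: "'k::field_char_0 tpoly"
  shows "group (Aut F)"
  using subgroup.subgroup_is_group[OF subgroup_Aut group_PGL3] by (simp flip: Aut_eq)

lemma one_Aut: "\<one>\<^bsub>Aut F\<^esub> = \<one>\<^bsub>PGL3\<^esub>"
  by (simp add: Aut_def)

lemma Aut_pow: 
  fixes F :: "'k::field_char_0 tpoly"
  shows "T [^]\<^bsub>Aut F\<^esub> (n::nat) = T [^]\<^bsub>PGL3\<^esub> n"
  by (simp add: Aut_def nat_pow_def)

text \<open>Turns the order in the projective group into the question which iterates of the linear
  map are scalar, the form in which diagonalization applies.\<close>

lemma ord_Aut_eq_iff:
  fixes F :: "'k::field_char_0 tpoly"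
  assumes "invertible A" "pgl_class A \<in> carrier (Aut F)"
  shows "group.ord (Aut F) (pgl_class A) = N \<longleftrightarrow>
    (\<forall>n. (\<exists>c. \<forall>v. ((*v) A ^^ n) v = c *s v) \<longleftrightarrow> N dvd n)"
  using group.ord_unique[OF group_Aut assms(2), of N]
  by (simp only: Aut_pow one_Aut pgl_class_pow_eq_one_iff[OF assms(1)])

section \<open>Linear maps preserving the model form\<close>

text \<open>The degree is written \<open>n + 4\<close>, so that \<open>d - 1\<close> is
  \<open>n + 3\<close> and exponents after two differentiations are sums rather than truncated
  differences.\<close>

definition model_poly :: "nat \<Rightarrow> 'k::field \<Rightarrow> 'k \<Rightarrow> 'k \<Rightarrow> 'k \<Rightarrow> 'k" where
  "model_poly n \<alpha> x y z = x ^ (n + 4) + y ^ (n + 3) * z + \<alpha> * x * z ^ (n + 3)"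

text \<open>The derivative of \<open>model_poly\<close> at \<open>(x, y, z)\<close> in the direction
  \<open>(v1, v2, v3)\<close>.\<close>

definition model_polar :: "nat \<Rightarrow> 'k::field \<Rightarrow> 'k \<Rightarrow> 'k \<Rightarrow> 'k \<Rightarrow> 'k \<Rightarrow> 'k \<Rightarrow> 'k \<Rightarrow> 'k" where
  "model_polar n \<alpha> v1 v2 v3 x y z =
     v1 * (of_nat (n + 4) * x ^ (n + 3) + \<alpha> * z ^ (n + 3))
     + v2 * (of_nat (n + 3) * y ^ (n + 2) * z)
     + v3 * (y ^ (n + 3) + \<alpha> * of_nat (n + 3) * x * z ^ (n + 2))"

text \<open>The Hessian bilinear form at \<open>(x, y, z)\<close> of the directions \<open>u\<close>
  and \<open>v\<close>, with the common factor \<open>n + 3\<close> pulled out.\<close>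

definition model_hess ::
  "nat \<Rightarrow> 'k::field \<Rightarrow> 'k \<Rightarrow> 'k \<Rightarrow> 'k \<Rightarrow> 'k \<Rightarrow> 'k \<Rightarrow> 'k \<Rightarrow> 'k \<Rightarrow> 'k \<Rightarrow> 'k \<Rightarrow> 'k" where
  "model_hess n \<alpha> u1 u2 u3 v1 v2 v3 x y z =
     of_nat (n + 3) * (u1 * (v1 * of_nat (n + 4) * x ^ (n + 2) + v3 * \<alpha> * z ^ (n + 2))
     + u2 * (v2 * of_nat (n + 2) * y ^ (n + 1) * z + v3 * y ^ (n + 2))
     + u3 * (v1 * \<alpha> * z ^ (n + 2) + v2 * y ^ (n + 2) + v3 * \<alpha> * of_nat (n + 2) * x * z ^ (n + 1)))"

lemma pderiv_at_0_eq:
  fixes P Q :: "'k::field_char_0 poly"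
  assumes "\<And>t. poly P t = c * poly Q t"
  shows "poly (pderiv P) 0 = c * poly (pderiv Q) 0"
proof -
  have "poly P = poly (Polynomial.smult c Q)" using assms by auto
  then have "P = Polynomial.smult c Q" by (simp only: poly_eq_poly_eq_iff)
  then show ?thesis by (simp add: pderiv_smult)
qed

lemma pderiv_power_add_numeral:
  "pderiv (p ^ (n + numeral k)) = Polynomial.smult (of_nat (n + numeral k)) (p ^ (n + pred_numeral k) * pderiv p)"
  by (subst pderiv_power) (simp add: numeral_eq_Suc)

text \<open>\<open>P\<close> is the form restricted to a line; comparing derivatives at
  \<open>t = 0\<close> transfers an invariance of the form to its polars.\<close>

lemma model_polar_eq:
  fixes \<alpha> :: "'k::field_char_0"
  assumes "\<And>t. model_poly n \<alpha> (x + t * v1) (y + t * v2) (z + t * v3)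
    = c * model_poly n \<alpha> (x' + t * v1') (y' + t * v2') (z' + t * v3')"
  shows "model_polar n \<alpha> v1 v2 v3 x y z = c * model_polar n \<alpha> v1' v2' v3' x' y' z'"
proof -
  define P where "P x y z v1 v2 v3 = [:x, v1:] ^ (n + 4) + [:y, v2:] ^ (n + 3) * [:z, v3:]
    + Polynomial.smult \<alpha> ([:x, v1:] * [:z, v3:] ^ (n + 3))" for x y z v1 v2 v3
  have "poly (P x y z v1 v2 v3) t = model_poly n \<alpha> (x + t * v1) (y + t * v2) (z + t * v3)" for t x y z v1 v2 v3
    by (simp add: P_def model_poly_def mult_ac del: mult_pCons_left mult_pCons_right)
  moreover have "poly (pderiv (P x y z v1 v2 v3)) 0 = model_polar n \<alpha> v1 v2 v3 x y z" for x y z v1 v2 v3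
    unfolding P_def model_polar_def pderiv_add pderiv_mult pderiv_smult pderiv_power_add_numeral
    by (simp add: pderiv_pCons algebra_simps)
  ultimately show ?thesis
    using pderiv_at_0_eq[of "P x y z v1 v2 v3" c "P x' y' z' v1' v2' v3'"] assms by simp
qed

lemma model_hess_eq:
  fixes \<alpha> :: "'k::field_char_0"
  assumes "\<And>t. model_polar n \<alpha> v1 v2 v3 (x + t * u1) (y + t * u2) (z + t * u3)
    = c * model_polar n \<alpha> v1' v2' v3' (x' + t * u1') (y' + t * u2') (z' + t * u3')"
  shows "model_hess n \<alpha> u1 u2 u3 v1 v2 v3 x y z = c * model_hess n \<alpha> u1' u2' u3' v1' v2' v3' x' y' z'"
proof -
  define P where "P v1 v2 v3 x y z u1 u2 u3 =
     Polynomial.smult v1 (Polynomial.smult (of_nat (n + 4)) ([:x, u1:] ^ (n + 3)) + Polynomial.smult \<alpha> ([:z, u3:] ^ (n + 3)))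
     + Polynomial.smult v2 (Polynomial.smult (of_nat (n + 3)) ([:y, u2:] ^ (n + 2) * [:z, u3:]))
     + Polynomial.smult v3 ([:y, u2:] ^ (n + 3) + Polynomial.smult (\<alpha> * of_nat (n + 3)) ([:x, u1:] * [:z, u3:] ^ (n + 2)))"
    for v1 v2 v3 x y z u1 u2 u3
  have "poly (P v1 v2 v3 x y z u1 u2 u3) t = model_polar n \<alpha> v1 v2 v3 (x + t * u1) (y + t * u2) (z + t * u3)"
    for v1 v2 v3 x y z u1 u2 u3 t
    by (simp add: P_def model_polar_def mult_ac del: mult_pCons_left mult_pCons_right)
  moreover have "poly (pderiv (P v1 v2 v3 x y z u1 u2 u3)) 0 = model_hess n \<alpha> u1 u2 u3 v1 v2 v3 x y z"
    for v1 v2 v3 x y z u1 u2 u3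
    unfolding P_def model_hess_def pderiv_add pderiv_mult pderiv_smult pderiv_power_add_numeral
    by (simp add: pderiv_pCons algebra_simps)
  ultimately show ?thesis
    using pderiv_at_0_eq[of "P v1 v2 v3 x y z u1 u2 u3" c "P v1' v2' v3' x' y' z' u1' u2' u3'"] assms by simp
qed

text \<open>
  The second polar of \<open>model_poly\<close> in direction \<open>v\<close>, that is, the vector Hessian times \<open>v\<close>, vanishes on
  a whole plane only for \<open>v\<close> proportional to \<open>(0, 1, 0)\<close>, and the plane is then \<open>y = 0\<close>.  Hence this
  point and this plane are preserved; what remains follows by comparing coefficients.
\<close>

lemma model_poly_preserving_diagonal:
  fixes a11 a12 a13 a21 a22 a23 a31 a32 a33 c \<alpha> :: "'k::field_char_0"
  assumes inv: "\<And>x y z. model_poly n \<alpha> (a11 * x + a12 * y + a13 * z) (a21 * x + a22 * y + a23 * z) (a31 * x + a32 * y + a33 * z)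
      = c * model_poly n \<alpha> x y z"
    and det: "a11 * a22 * a33 + a12 * a23 * a31 + a13 * a21 * a32
       - a11 * a23 * a32 - a12 * a21 * a33 - a13 * a22 * a31 \<noteq> 0"
    and "\<alpha> \<noteq> 0"
  shows "a12 = 0 \<and> a13 = 0 \<and> a21 = 0 \<and> a23 = 0 \<and> a31 = 0 \<and> a32 = 0 \<and>
    a11 ^ (n + 4) = c \<and> a22 ^ (n + 3) * a33 = c \<and> a11 * a33 ^ (n + 3) = c"
proof -
  define L1 where "L1 x y z = a11 * x + a12 * y + a13 * z" for x y z
  define L2 where "L2 x y z = a21 * x + a22 * y + a23 * z" for x y z
  define L3 where "L3 x y z = a31 * x + a32 * y + a33 * z" for x y z
  note L = L1_def L2_def L3_def
  have L_add: "L1 (x + t * u) (y + t * v) (z + t * w) = L1 x y z + t * L1 u v w"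
    "L2 (x + t * u) (y + t * v) (z + t * w) = L2 x y z + t * L2 u v w"
    "L3 (x + t * u) (y + t * v) (z + t * w) = L3 x y z + t * L3 u v w" for x y z t u v w
    by (simp_all add: L algebra_simps)
  have polar: "model_polar n \<alpha> (L1 u v w) (L2 u v w) (L3 u v w) (L1 x y z) (L2 x y z) (L3 x y z)
      = c * model_polar n \<alpha> u v w x y z" for u v w x y z
    by (rule model_polar_eq) (simp flip: L_add, simp add: L inv)
  have hess: "model_hess n \<alpha> (L1 p q r) (L2 p q r) (L3 p q r) (L1 u v w) (L2 u v w) (L3 u v w) (L1 x y z) (L2 x y z) (L3 x y z)
      = c * model_hess n \<alpha> p q r u v w x y z" for p q r u v w x y z
    by (rule model_hess_eq) (simp flip: L_add, rule polar)
  \<comment> \<open>Cramer's rule for the transposed matrix: the determinant times each unknown is a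
    combination of the three equations with cofactors as coefficients.\<close>
  have lin: "h1 = 0 \<and> h2 = 0 \<and> h3 = 0"
    if "a11 * h1 + a21 * h2 + a31 * h3 = 0" "a12 * h1 + a22 * h2 + a32 * h3 = 0" "a13 * h1 + a23 * h2 + a33 * h3 = 0"
    for h1 h2 h3
  proof -
    let ?D = "a11 * a22 * a33 + a12 * a23 * a31 + a13 * a21 * a32
       - a11 * a23 * a32 - a12 * a21 * a33 - a13 * a22 * a31"
    have "?D * h1 = (a22 * a33 - a23 * a32) * (a11 * h1 + a21 * h2 + a31 * h3)
        + (a23 * a31 - a21 * a33) * (a12 * h1 + a22 * h2 + a32 * h3)
        + (a21 * a32 - a22 * a31) * (a13 * h1 + a23 * h2 + a33 * h3)"
      "?D * h2 = (a13 * a32 - a12 * a33) * (a11 * h1 + a21 * h2 + a31 * h3)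
        + (a11 * a33 - a13 * a31) * (a12 * h1 + a22 * h2 + a32 * h3)
        + (a12 * a31 - a11 * a32) * (a13 * h1 + a23 * h2 + a33 * h3)"
      "?D * h3 = (a12 * a23 - a13 * a22) * (a11 * h1 + a21 * h2 + a31 * h3)
        + (a13 * a21 - a11 * a23) * (a12 * h1 + a22 * h2 + a32 * h3)
        + (a11 * a22 - a12 * a21) * (a13 * h1 + a23 * h2 + a33 * h3)"
      by (simp_all add: algebra_simps)
    then have "?D * h1 = 0" "?D * h2 = 0" "?D * h3 = 0" by (simp_all only: that mult_zero_right add_0_left)
    then show ?thesis using det by simp
  qed
  \<comment> \<open>On the plane \<open>y = 0\<close> the direction \<open>(0, 1, 0)\<close> pairs
    to zero with every direction, since \<open>y\<close> occurs with a positive power.\<close>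
  have hess_e2: "model_hess n \<alpha> u1 u2 u3 0 1 0 x 0 z = 0" for u1 u2 u3 x z
    by (simp add: model_hess_def)
  have nz: "(of_nat (n + 4) :: 'k) \<noteq> 0" "(of_nat (n + 3) :: 'k) \<noteq> 0" "(of_nat (n + 2) :: 'k) \<noteq> 0"
    by (simp_all only: of_nat_eq_0_iff)
  have L_e1: "L1 1 0 0 = a11" "L2 1 0 0 = a21" "L3 1 0 0 = a31"
    and L_e2: "L1 0 1 0 = a12" "L2 0 1 0 = a22" "L3 0 1 0 = a32"
    and L_e3: "L1 0 0 1 = a13" "L2 0 0 1 = a23" "L3 0 0 1 = a33" by (simp_all add: L)
  note L_e = L_e1 L_e2 L_e3
  \<comment> \<open>The second column is the image of \<open>(0, 1, 0)\<close>, so the Hessian of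
    the model times this column vanishes on the image of the plane \<open>y = 0\<close>. These are
    its three components without the factor \<open>n + 3\<close>; pairing with the images of the
    axes is undone by \<open>lin\<close>.\<close>
  have eqs: "a12 * of_nat (n + 4) * L1 x 0 z ^ (n + 2) + a32 * \<alpha> * L3 x 0 z ^ (n + 2) = 0"
    "a22 * of_nat (n + 2) * L2 x 0 z ^ (n + 1) * L3 x 0 z + a32 * L2 x 0 z ^ (n + 2) = 0"
    "a12 * \<alpha> * L3 x 0 z ^ (n + 2) + a22 * L2 x 0 z ^ (n + 2) + a32 * \<alpha> * of_nat (n + 2) * L1 x 0 z * L3 x 0 z ^ (n + 1) = 0"
    for x z
  proof -
    have "a11 * (a12 * of_nat (n + 4) * L1 x 0 z ^ (n + 2) + a32 * \<alpha> * L3 x 0 z ^ (n + 2))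
      + a21 * (a22 * of_nat (n + 2) * L2 x 0 z ^ (n + 1) * L3 x 0 z + a32 * L2 x 0 z ^ (n + 2))
      + a31 * (a12 * \<alpha> * L3 x 0 z ^ (n + 2) + a22 * L2 x 0 z ^ (n + 2) + a32 * \<alpha> * of_nat (n + 2) * L1 x 0 z * L3 x 0 z ^ (n + 1)) = 0"
     "a12 * (a12 * of_nat (n + 4) * L1 x 0 z ^ (n + 2) + a32 * \<alpha> * L3 x 0 z ^ (n + 2))
      + a22 * (a22 * of_nat (n + 2) * L2 x 0 z ^ (n + 1) * L3 x 0 z + a32 * L2 x 0 z ^ (n + 2))
      + a32 * (a12 * \<alpha> * L3 x 0 z ^ (n + 2) + a22 * L2 x 0 z ^ (n + 2) + a32 * \<alpha> * of_nat (n + 2) * L1 x 0 z * L3 x 0 z ^ (n + 1)) = 0"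
     "a13 * (a12 * of_nat (n + 4) * L1 x 0 z ^ (n + 2) + a32 * \<alpha> * L3 x 0 z ^ (n + 2))
      + a23 * (a22 * of_nat (n + 2) * L2 x 0 z ^ (n + 1) * L3 x 0 z + a32 * L2 x 0 z ^ (n + 2))
      + a33 * (a12 * \<alpha> * L3 x 0 z ^ (n + 2) + a22 * L2 x 0 z ^ (n + 2) + a32 * \<alpha> * of_nat (n + 2) * L1 x 0 z * L3 x 0 z ^ (n + 1)) = 0"
      using hess[of 1 0 0 0 1 0 x 0 z] hess[of 0 1 0 0 1 0 x 0 z] hess[of 0 0 1 0 1 0 x 0 z] nz(2)
      unfolding hess_e2 L_e by (simp_all only: model_hess_def mult_zero_right mult_eq_0_iff simp_thms)
    from lin[OF this] show "a12 * of_nat (n + 4) * L1 x 0 z ^ (n + 2) + a32 * \<alpha> * L3 x 0 z ^ (n + 2) = 0"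
    "a22 * of_nat (n + 2) * L2 x 0 z ^ (n + 1) * L3 x 0 z + a32 * L2 x 0 z ^ (n + 2) = 0"
    "a12 * \<alpha> * L3 x 0 z ^ (n + 2) + a22 * L2 x 0 z ^ (n + 2) + a32 * \<alpha> * of_nat (n + 2) * L1 x 0 z * L3 x 0 z ^ (n + 1) = 0"
      by blast+
  qed
  \<comment> \<open>The image of the plane \<open>y = 0\<close> is again a plane, hence contains a
    non-zero point whose third coordinate is 0.\<close>
  have "\<exists>x z. L3 x 0 z = 0 \<and> (L1 x 0 z \<noteq> 0 \<or> L2 x 0 z \<noteq> 0)"
  proof (cases "a31 = 0 \<and> a33 = 0")
    case True
    then have "a11 \<noteq> 0 \<or> a21 \<noteq> 0" using det by auto
    then show ?thesis using True by (intro exI[of _ 1] exI[of _ 0]) (simp add: L)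
  next
    case False
    have "L1 a33 0 (- a31) \<noteq> 0 \<or> L2 a33 0 (- a31) \<noteq> 0"
    proof (rule ccontr)
      assume "\<not> ?thesis"
      then have uw: "a11 * a33 - a13 * a31 = 0" "a21 * a33 - a23 * a31 = 0" by (auto simp: L)
      let ?D = "a11 * a22 * a33 + a12 * a23 * a31 + a13 * a21 * a32
         - a11 * a23 * a32 - a12 * a21 * a33 - a13 * a22 * a31"
      have "a33 * ?D = (a11 * a33 - a13 * a31) * (a22 * a33 - a23 * a32) - (a21 * a33 - a23 * a31) * (a12 * a33 - a13 * a32)"
        "a31 * ?D = (a21 * a33 - a23 * a31) * (a11 * a32 - a12 * a31) - (a11 * a33 - a13 * a31) * (a21 * a32 - a22 * a31)"
        by (simp_all add: algebra_simps)
      then have "a33 * ?D = 0" "a31 * ?D = 0" by (simp_all only: uw mult_zero_left diff_0_right)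
      then show False using det False by auto
    qed
    then show ?thesis by (intro exI[of _ a33] exI[of _ "- a31"]) (simp add: L)
  qed
  then obtain x0 z0 where q: "L3 x0 0 z0 = 0" "L1 x0 0 z0 \<noteq> 0 \<or> L2 x0 0 z0 \<noteq> 0" by blast
  note eqs1 = eqs[of 1 0, unfolded L_e1] and eqs3 = eqs[of 0 1, unfolded L_e3]
  \<comment> \<open>Otherwise the equations at this point reduce the second column to
    \<open>(a12, 0, 0)\<close>; those at the first and third axes then make \<open>L1\<close> and
    \<open>L3\<close> vanish on all of \<open>y = 0\<close>, and the determinant is zero.\<close>
  have "L2 x0 0 z0 = 0"
  proof (rule ccontr)
    assume "L2 x0 0 z0 \<noteq> 0"
    then have "a32 = 0" "a22 = 0" using eqs(2,3)[of x0 z0] q(1) by auto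
    moreover from this have "a12 \<noteq> 0" using det by auto
    ultimately have "a11 = 0" "a13 = 0" "a31 = 0" "a33 = 0"
      using eqs1(1,3) eqs3(1,3) nz \<open>\<alpha> \<noteq> 0\<close> by (auto simp del: of_nat_add)
    then show False using det by auto
  qed
  then have "a12 = 0" using eqs(1)[of x0 z0] q nz by (auto simp del: of_nat_add)
  \<comment> \<open>If \<open>a32\<close> were non-zero, the first equation would make
    \<open>L3\<close> vanish on \<open>y = 0\<close>, then the second would do the same to
    \<open>L2\<close>; one remaining coordinate cannot be injective on a plane.\<close>
  have "a32 = 0"
  proof (rule ccontr)
    assume "a32 \<noteq> 0"
    then have "a31 = 0" "a33 = 0" using eqs1(1) eqs3(1) \<open>a12 = 0\<close> \<open>\<alpha> \<noteq> 0\<close> by auto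
    moreover from this have "a21 = 0" "a23 = 0" using eqs1(2) eqs3(2) \<open>a32 \<noteq> 0\<close> by auto
    ultimately show False using det by auto
  qed
  then have "a22 \<noteq> 0" using \<open>a12 = 0\<close> det by auto
  then have "a21 = 0" "a23 = 0" using eqs1(3) eqs3(3) \<open>a12 = 0\<close> \<open>a32 = 0\<close> by auto
  note zero = \<open>a12 = 0\<close> \<open>a32 = 0\<close> \<open>a21 = 0\<close> \<open>a23 = 0\<close>
  have pow0: "(0::'k) ^ (n + 3) = 0" "(0::'k) ^ (n + 4) = 0" by simp_all
  \<comment> \<open>Only the middle monomial of the model still involves \<open>y\<close>, so
    subtracting the invariance at \<open>y = 0\<close> from that at \<open>y = 1\<close> isolates
    it.\<close>
  have y: "a22 ^ (n + 3) * (a31 * x + a33 * z) = c * z" for x z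
    using inv[of x 1 z] inv[of x 0 z] by (simp add: zero model_poly_def pow0) (simp add: algebra_simps)
  have "a31 = 0" using y[of 1 0] \<open>a22 \<noteq> 0\<close> by simp
  have c2: "a22 ^ (n + 3) * a33 = c" using y[of 0 1] by simp
  have c1: "a11 ^ (n + 4) = c" using inv[of 1 0 0] by (simp add: zero \<open>a31 = 0\<close> model_poly_def pow0)
  have "a11 \<noteq> 0" using det zero \<open>a31 = 0\<close> by auto
  \<comment> \<open>This compares coefficients of \<open>x ^ (n + 3) * z\<close>, a monomial absent
    from the model.\<close>
  have "model_polar n \<alpha> a13 0 a33 a11 0 0 = 0"
    using polar[of 0 0 1 1 0 0] by (simp add: L_e1 L_e3 zero \<open>a31 = 0\<close>) (simp add: model_polar_def)
  then have "a13 = 0" using nz \<open>a11 \<noteq> 0\<close> by (simp add: model_polar_def pow0 del: of_nat_add)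
  have "a11 * a33 ^ (n + 3) = c"
    using inv[of 1 0 1] c1 \<open>\<alpha> \<noteq> 0\<close> by (simp add: zero \<open>a31 = 0\<close> \<open>a13 = 0\<close> model_poly_def pow0 distrib_left mult_ac)
  then show ?thesis using zero \<open>a31 = 0\<close> \<open>a13 = 0\<close> c1 c2 by blast
qed

section \<open>Weights of a diagonal automorphism\<close>

lemma mono_at_axis_nonzero_iff:
  "mono_at m (axis i 1 :: 'k::field^3) \<noteq> 0 \<longleftrightarrow> (\<forall>l. l \<noteq> i \<longrightarrow> Poly_Mapping.lookup m l = 0)"
  by (auto simp: mono_at_def axis_def power_0_left)

text \<open>At the \<open>i\<close>-th coordinate point either \<open>F\<close> is non-zero, which
  needs the \<open>d\<close>-th power of the \<open>i\<close>-th variable, or its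
  \<open>j\<close>-th partial derivative is for some \<open>j\<close>, which needs the
  \<open>(d - 1)\<close>-th power times the \<open>j\<close>-th variable. The first case is covered
  by \<open>j = i\<close>.\<close>

lemma nonsingular_monomial:
  fixes F :: "'k::field_char_0 tpoly"
  assumes F: "nonsingular_plane_curve d F" and "d > 0"
  shows "\<exists>j. \<exists>m\<in>Poly_Mapping.keys F.
    \<forall>l. Poly_Mapping.lookup m l = (if l = i then d - 1 else 0) + (if l = j then 1 else 0)"
proof -
  have deg: "Poly_Mapping.lookup m i + (\<Sum>l\<in>UNIV - {i}. Poly_Mapping.lookup m l) = d"
    if "m \<in> Poly_Mapping.keys F" for m
    using F that sum.remove[of UNIV i "Poly_Mapping.lookup m"]
    by (auto simp: nonsingular_plane_curve_def homogeneous_def)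
  show ?thesis
  proof (cases "poly_at F (axis i 1) = 0")
    case False
    then obtain m where m: "m \<in> Poly_Mapping.keys F" "mono_at m (axis i 1 :: 'k^3) \<noteq> 0"
      by (auto simp: poly_at_eq elim!: sum.not_neutral_contains_not_neutral)
    then have "Poly_Mapping.lookup m i = d" using deg[of m] by (simp add: mono_at_axis_nonzero_iff)
    then show ?thesis using m \<open>d > 0\<close> unfolding mono_at_axis_nonzero_iff
      by (intro exI[of _ i] bexI[of _ m]) auto
  next
    case True
    moreover have "(axis i 1 :: 'k^3) \<noteq> 0" by (simp add: axis_eq_0_iff)
    ultimately obtain j where "poly_at (partial_deriv j F) (axis i 1) \<noteq> 0"
      using F unfolding nonsingular_plane_curve_def by blast
    then obtain m where m: "m \<in> Poly_Mapping.keys F" "Poly_Mapping.lookup m j \<noteq> 0"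
      "mono_at (m - Poly_Mapping.single j 1) (axis i 1 :: 'k^3) \<noteq> 0"
      by (auto simp: partial_deriv_def elim!: sum.not_neutral_contains_not_neutral)
    then have l: "Poly_Mapping.lookup m l = (if l = j then 1 else 0)" if "l \<noteq> i" for l
      using that unfolding mono_at_axis_nonzero_iff
      by (auto simp: lookup_minus lookup_single when_def split: if_splits dest!: spec[of _ l])
    have "(\<Sum>l\<in>UNIV - {i}. Poly_Mapping.lookup m l) = (\<Sum>l\<in>UNIV - {i}. if l = j then 1 else 0)"
      by (rule sum.cong) (auto simp: l)
    then have "Poly_Mapping.lookup m i + (if j = i then 0 else 1) = d"
      using deg[OF m(1)] by (simp split: if_splits)
    then show ?thesis using m(1) l \<open>d > 0\<close>
      by (intro exI[of _ j] bexI[of _ m]) (auto split: if_splits)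
  qed
qed

text \<open>A diagonal substitution multiplies each monomial by its own value at \<open>t\<close>,
  so coefficients can be compared one by one.\<close>

lemma mono_at_eq_if_diagonal_invariant:
  fixes F :: "'k::field_char_0 tpoly"
  assumes inv: "\<And>q. poly_at F (\<chi> i. t i * q $ i) = c * poly_at F q" and m: "m \<in> Poly_Mapping.keys F"
  shows "mono_at m (\<chi> i. t i) = c"
proof -
  have mono: "mono_at m (\<chi> i. t i * q $ i) = mono_at m (\<chi> i. t i) * mono_at m q" for m q
    by (simp add: mono_at_def power_mult_distrib prod.distrib)
  have "(\<Sum>m\<in>Poly_Mapping.keys F. (Poly_Mapping.lookup F m * (mono_at m (\<chi> i. t i) - c)) * mono_at m q) = 0" for q
    using inv[of q] unfolding poly_at_eq mono
    by (simp add: sum_distrib_left algebra_simps sum_subtractf)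
  from coeffs_eq_0_if_mono_sum_eq_0[OF _ this m] show ?thesis using m by (simp add: in_keys_iff)
qed

text \<open>
  Up to relabelling there are seven maps \<open>f\<close>.  For all but one of them some power \<open>m\<close> not divisible by
  \<open>e\<^sup>2\<close> equalises the weights: \<open>e\<^sup>2 - 1\<close> if \<open>f\<close> is an involution or the identity, \<open>e\<^sup>3 + 1\<close> if it is a
  3-cycle, \<open>e\<close> if it is constant, \<open>e (e + 1)\<close> if it has two fixed points, and \<open>e (e - 1)\<close> if it swaps two
  indices and is not injective.
\<close>

lemma weights_of_large_order:
  fixes t :: "3 \<Rightarrow> 'k::field"
  assumes w: "\<And>i. t i ^ e * t (f i) = c" and t: "\<And>i. t i \<noteq> 0" and e: "e \<ge> 3"
    and ord: "\<And>m. (\<And>i j. t i ^ m = t j ^ m) \<Longrightarrow> e\<^sup>2 dvd m"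
  shows "\<exists>i j k. i \<noteq> j \<and> j \<noteq> k \<and> i \<noteq> k \<and> f i = i \<and> f j = k \<and> f k = i"
proof -
  have c: "c \<noteq> 0" using w[of 1] t by auto
  \<comment> \<open>Iterating this relation expresses the power of \<open>t i\<close> with exponent
    \<open>e ^ k\<close>, up to a factor independent of \<open>i\<close>, by the weight at the
    \<open>k\<close>-th iterate of \<open>f\<close> or its inverse, in alternation.\<close>
  have w1: "t i ^ e = c / t (f i)" for i using w[of i] t by (simp add: field_simps)
  have w2: "t i ^ e\<^sup>2 = c ^ e / c * t (f (f i))" for i
    by (simp add: power2_eq_square power_mult w1 power_divide)
  have w3: "t i ^ (e ^ 3) = c ^ (e\<^sup>2) / c ^ e * c / t (f (f (f i)))" for i
    by (simp add: power3_eq_cube power_mult w1 power_divide power2_eq_square power_mult_distrib)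
  have dvd1: "\<not> e\<^sup>2 dvd e" using e by (auto dest!: dvd_imp_le simp: power2_eq_square)
  have e2: "e\<^sup>2 \<ge> 9" using power_mono[OF e, of 2] by simp
  have "\<not> (\<forall>i. f (f i) = i)"
  proof
    assume f: "\<forall>i. f (f i) = i"
    have "t i ^ (e\<^sup>2 - 1) = c ^ e / c" for i
    proof -
      have "t i * t i ^ (e\<^sup>2 - 1) = t i ^ e\<^sup>2" using e by (cases "e\<^sup>2") auto
      also have "\<dots> = t i * (c ^ e / c)" using w2[of i] f by simp
      finally show ?thesis using t[of i] by (rule mult_left_cancel[THEN iffD1, rotated])
    qed
    then have "e\<^sup>2 dvd e\<^sup>2 - 1" by (intro ord) simp
    then have "e\<^sup>2 \<le> e\<^sup>2 - 1" using e2 by (intro dvd_imp_le) linarith+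
    then show False using e2 by linarith
  qed
  moreover have "\<not> (\<forall>i. f (f (f i)) = i)"
  proof
    assume f: "\<forall>i. f (f (f i)) = i"
    have "t i ^ (e ^ 3 + 1) = c ^ (e\<^sup>2) / c ^ e * c" for i
      using w3[of i] f t[of i] by (simp add: field_simps)
    then have "e\<^sup>2 dvd e ^ 3 + 1" by (intro ord) simp
    moreover have "e\<^sup>2 dvd e ^ 3" by (rule le_imp_power_dvd) simp
    ultimately have "e\<^sup>2 dvd 1" by (rule dvd_add_right_iff[THEN iffD1, rotated])
    then show False using e by simp
  qed
  moreover have "\<not> (\<forall>i. f i = k)" for k
  proof
    assume "\<forall>i. f i = k"
    then have "e\<^sup>2 dvd e" by (intro ord) (simp add: w1)
    then show False using dvd1 by simp
  qed
  moreover have "\<not> (f i = i \<and> f j = i \<and> f k = k)" if "i \<noteq> j" "j \<noteq> k" "i \<noteq> k" for i j k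
  proof
    assume f: "f i = i \<and> f j = i \<and> f k = k"
    have 1: "t i ^ (e + 1) = c" "t k ^ (e + 1) = c" using w[of i] w[of k] f by (simp_all add: mult.commute)
    have "t l ^ (e * (e + 1)) = c ^ e" if "l = i \<or> l = k" for l
      using that 1 by (metis mult.commute power_mult)
    moreover have "t j ^ (e * (e + 1)) = c ^ e"
    proof -
      have "t j ^ (e * (e + 1)) = (c / t i) ^ (e + 1)" using f by (simp only: power_mult w1)
      also have "\<dots> = c ^ (e + 1) / c" by (simp only: power_divide 1)
      finally show ?thesis using c by simp
    qed
    moreover have "l = i \<or> l = j \<or> l = k" for l
      using that exhaust_3[of i] exhaust_3[of j] exhaust_3[of k] exhaust_3[of l] by auto
    ultimately have "t l ^ (e * (e + 1)) = c ^ e" for l by metis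
    then have "e\<^sup>2 dvd e * (e + 1)" by (intro ord) metis
    then have "e dvd e + 1" using e by (simp add: power2_eq_square)
    then have "e dvd 1" using dvd_add_right_iff dvd_refl by blast
    then show False using e by simp
  qed
  moreover have "\<not> (f i = j \<and> f j = i \<and> f k = i)" if "i \<noteq> j" "j \<noteq> k" "i \<noteq> k" for i j k
  proof
    assume f: "f i = j \<and> f j = i \<and> f k = i"
    have "t j ^ e = t k ^ e" using f by (simp add: w1)
    then have 1: "t j ^ (e * (e - 1)) = t k ^ (e * (e - 1))" by (simp add: power_mult)
    have pm: "t l ^ e = t l ^ (e - 1) * t l" for l using e by (cases e) (simp_all add: mult.commute)
    \<comment> \<open>Cancelling \<open>t i * t j\<close> in the relation of the swapped pair
      equates their powers with exponent \<open>e - 1\<close>; with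
      \<open>t j ^ e = t k ^ e\<close>, exponent \<open>e * (e - 1)\<close> serves all
      three.\<close>
    have "t i ^ e * t j = t j ^ e * t i" using w[of i] w[of j] f by simp
    then have "t i ^ (e - 1) * (t i * t j) = t j ^ (e - 1) * (t i * t j)"
      unfolding pm by (simp only: mult_ac)
    then have "t i ^ (e - 1) = t j ^ (e - 1)" using t[of i] t[of j] by simp
    then have 2: "t i ^ (e * (e - 1)) = t j ^ (e * (e - 1))" by (metis mult.commute power_mult)
    moreover have "l = i \<or> l = j \<or> l = k" for l
      using that exhaust_3[of i] exhaust_3[of j] exhaust_3[of k] exhaust_3[of l] by auto
    ultimately have "t l ^ (e * (e - 1)) = t j ^ (e * (e - 1))" for l using 1 by metis
    then have "e\<^sup>2 dvd e * (e - 1)" by (intro ord) metis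
    then have "e dvd e - 1" using e by (simp add: power2_eq_square)
    then have "e \<le> e - 1" using e by (intro dvd_imp_le) auto
    then show False using e by simp
  qed
  ultimately show ?thesis
  proof (rule_tac ccontr)
    assume not: "\<not> (\<forall>i. f (f i) = i)" "\<not> (\<forall>i. f (f (f i)) = i)"
      "\<And>k. \<not> (\<forall>i. f i = k)"
      "\<And>i j k. i \<noteq> j \<Longrightarrow> j \<noteq> k \<Longrightarrow> i \<noteq> k \<Longrightarrow> \<not> (f i = i \<and> f j = i \<and> f k = k)"
      "\<And>i j k. i \<noteq> j \<Longrightarrow> j \<noteq> k \<Longrightarrow> i \<noteq> k \<Longrightarrow> \<not> (f i = j \<and> f j = i \<and> f k = i)"
      and "\<not> ?thesis"
    then have 6: "\<And>i j k. i \<noteq> j \<Longrightarrow> j \<noteq> k \<Longrightarrow> i \<noteq> k \<Longrightarrow> \<not> (f i = i \<and> f j = k \<and> f k = i)" by metis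
    note * = not(4)[of 1 2 3] not(4)[of 1 3 2] not(4)[of 2 1 3] not(4)[of 2 3 1] not(4)[of 3 1 2] not(4)[of 3 2 1]
      not(5)[of 1 2 3] not(5)[of 1 3 2] not(5)[of 2 1 3] not(5)[of 2 3 1] not(5)[of 3 1 2] not(5)[of 3 2 1]
      6[of 1 2 3] 6[of 1 3 2] 6[of 2 1 3] 6[of 2 3 1] 6[of 3 1 2] 6[of 3 2 1] not(3)[of 1] not(3)[of 2] not(3)[of 3]
    \<comment> \<open>All 27 maps are enumerated; each matches one of the excluded patterns in some
      labelling.\<close>
    show False
      using exhaust_3[of "f 1"] exhaust_3[of "f 2"] exhaust_3[of "f 3"] * not(1,2)
      unfolding forall_3 by (elim disjE) simp_all
  qed
qed

text \<open>\<open>b\<close> and \<open>r\<close> are the exponents of \<open>Y\<close> and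
  \<open>Z\<close>. For weights 1, \<open>w\<close> and \<open>inverse w ^ e\<close> with
  \<open>w\<close> of order \<open>e\<^sup>2\<close>, the divisibility says that the monomial has
  the weight of \<open>X ^ d\<close>. Modulo \<open>e\<close> and with the degree bound it leaves
  \<open>b = 0\<close> or \<open>b = e\<close>; the quotient by \<open>e\<close> then fixes
  \<open>r\<close>.\<close>

lemma model_monomials:
  fixes a b r e :: nat
  assumes e: "e \<ge> 3" and deg: "a + b + r = e + 1" and dvd: "int e ^ 2 dvd int b - int e * int r"
  shows "b = 0 \<and> r = 0 \<or> b = e \<and> r = 1 \<or> b = 0 \<and> r = e"
proof -
  have ediv: "int e dvd int b - int e * int r"
    using dvd by (rule dvd_trans[rotated]) (simp add: power2_eq_square)
  then have "int e dvd (int b - int e * int r) + int e * int r" by (intro dvd_add) auto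
  then have "e dvd b" by (simp add: int_dvd_int_iff)
  then obtain q where q: "b = e * q" by (auto simp: dvd_def)
  have "q < 2"
  proof (rule ccontr)
    assume "\<not> q < 2"
    then have "e * 2 \<le> e * q" by simp
    then show False using q deg e by linarith
  qed
  have "int b - int e * int r = int e * (int q - int r)" by (simp add: q algebra_simps)
  then have er: "int e dvd int q - int r" using dvd e by (simp add: power2_eq_square)
  consider "q = 0" | "q = 1" using \<open>q < 2\<close> by linarith
  then show ?thesis
  proof cases
    case 1
    then have "e dvd r" using er by (simp add: int_dvd_int_iff)
    then obtain s where s: "r = e * s" by (auto simp: dvd_def)
    have "s < 2"
    proof (rule ccontr)
      assume "\<not> s < 2"
      then have "e * 2 \<le> e * s" by simp
      then show False using s deg e by linarith
    qed
    then have "s = 0 \<or> s = 1" by auto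
    then show ?thesis using 1 q s by auto
  next
    case 2
    then have "r \<le> 1" using deg q by simp
    moreover have "r \<noteq> 0"
    proof
      assume "r = 0"
      then have "int e dvd 1" using er 2 by simp
      then show False using e by simp
    qed
    ultimately show ?thesis using 2 q by simp
  qed
qed

section \<open>Elements of large order\<close>

lemma matrix_vector_mult_3:
  fixes A :: "'k::field^3^3"
  shows "(A *v v) $ i = A $ i $ 1 * v $ 1 + A $ i $ 2 * v $ 2 + A $ i $ 3 * v $ 3"
  by (simp add: matrix_vector_mult_def sum_3)

lemma pgl_class_eqI:
  fixes A B :: "'k::field^3^3"
  assumes "a \<noteq> 0" "\<And>v. A *v v = a *s (B *v v)"
  shows "pgl_class A = pgl_class B"
proof -
  have A: "A = mat a ** B" using assms(2) by (simp add: matrix_eq_iff mat_mult_vec_assoc)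
  have "mat b ** A = mat (b * a) ** B" "mat b ** B = mat (b / a) ** A" for b
    using assms(1) by (simp_all add: A matrix_mul_assoc mat_mult_mat)
  then have "C \<in> pgl_class A \<longleftrightarrow> C \<in> pgl_class B" for C
    unfolding mem_pgl_class using assms(1) by (metis divide_eq_0_iff mult_eq_0_iff)
  then show ?thesis by blast
qed

lemma invertible_mult_vec_eq_0:
  fixes A :: "'k::field^'n^'n"
  assumes "invertible A"
  shows "A *v v = 0 \<longleftrightarrow> v = 0"
  using assms unfolding invertible_def
  by (metis matrix_vector_mul_assoc matrix_vector_mul_lid matrix_vector_mult_0_right)

lemma invertible_funpow_mult_vec_eq_0:
  fixes A :: "'k::field^'n^'n"
  assumes "invertible A"
  shows "((*v) A ^^ n) v = 0 \<longleftrightarrow> v = 0"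
  by (induction n) (simp_all add: invertible_mult_vec_eq_0[OF assms])

text \<open>Dividing \<open>A\<close> by an \<open>N\<close>-th root \<open>r\<close> of the scalar
  makes it periodic, hence diagonalizable; multiplying by \<open>r\<close> recovers the eigenvalues
  of \<open>A\<close>.\<close>

lemma scalar_power_diagonalizable:
  fixes A :: "'k::{alg_closed_field, field_char_0}^'n^'n"
  assumes A: "invertible A" and s: "\<And>v. ((*v) A ^^ N) v = s *s v" and "N > 0"
  shows "\<exists>(P :: 'k^'n^'n) t. invertible P \<and> (\<forall>i. t i \<noteq> 0) \<and>
    (\<forall>q. A *v (P *v q) = P *v (\<chi> i. t i * q $ i))"
proof -
  have "s \<noteq> 0"
  proof
    assume "s = 0"
    then have "((*v) A ^^ N) (axis undefined 1) = 0" by (simp add: s)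
    then show False by (simp add: invertible_funpow_mult_vec_eq_0[OF A] axis_eq_0_iff)
  qed
  obtain r where r: "r ^ N = s" using nth_root_exists[OF \<open>N > 0\<close>] by blast
  have r0: "r \<noteq> 0" using r \<open>s \<noteq> 0\<close> \<open>N > 0\<close> by (auto simp: power_0_left)
  define A' where "A' = mat (inverse r) ** A"
  have A': "A' *v v = inverse r *s (A *v v)" for v by (simp add: A'_def mat_mult_vec_assoc)
  have pow: "((*v) A' ^^ n) v = inverse r ^ n *s ((*v) A ^^ n) v" for n v
    by (induction n) (simp_all add: A' vector_scalar_commute vector_smult_assoc mult.commute)
  have "((*v) A' ^^ N) v = v" for v
    using r0 by (simp add: pow s power_inverse vector_smult_assoc flip: r)
  then obtain P :: "'k^'n^'n" and t where P: "invertible P" "\<And>i. A' *v column i P = t i *s column i P"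
    using finite_order_diagonalizable[OF _ \<open>N > 0\<close>, of A'] by metis
  have col: "A *v column i P = (r * t i) *s column i P" for i
  proof -
    have "A *v column i P = r *s (A' *v column i P)" using r0 by (simp add: A' vector_smult_assoc)
    then show ?thesis by (simp add: P(2) vector_smult_assoc)
  qed
  show ?thesis
  proof (intro exI conjI allI)
    show "invertible P" by (rule P(1))
  next
    fix i
    have "column i P \<noteq> 0"
    proof -
      have "column i P = P *v axis i 1"
        by (simp add: matrix_vector_mult_def column_def axis_def vec_eq_iff if_distrib[of "(*) _"] cong: if_cong)
      then show ?thesis by (simp add: invertible_mult_vec_eq_0[OF P(1)] axis_eq_0_iff)
    qed
    then have "A *v column i P \<noteq> 0" by (simp add: invertible_mult_vec_eq_0[OF A])
    then show "r * t i \<noteq> 0" unfolding col by auto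
  next
    fix q
    have "A *v (P *v q) = (\<Sum>i\<in>UNIV. A *v (q $ i *s column i P))"
      unfolding matrix_mult_sum[of P q] by (rule vec.linear_sum[OF matrix_vector_mul_linear_gen])
    also have "\<dots> = P *v (\<chi> i. r * t i * q $ i)"
      unfolding matrix_mult_sum[of P "\<chi> i. r * t i * q $ i"]
      by (simp add: vector_scalar_commute col vector_smult_assoc mult_ac)
    finally show "A *v (P *v q) = P *v (\<chi> i. r * t i * q $ i)" .
  qed
qed

lemma isomorphic_model_form_if_element_of_large_order:
  fixes F :: "'k::{alg_closed_field, field_char_0} tpoly"
  assumes F: "nonsingular_plane_curve d F" and d: "d \<ge> 4"
    and \<sigma>: "\<sigma> \<in> carrier (Aut F)" and ord: "group.ord (Aut F) \<sigma> = (d - 1)\<^sup>2"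
  shows "\<exists>\<alpha>. \<alpha> \<noteq> 0 \<and> isomorphic_curves F (model_form d \<alpha>)"
proof -
  define e where "e = d - 1"
  have e: "e \<ge> 3" "d = e + 1" using d by (auto simp: e_def)
  obtain A c where A: "\<sigma> = pgl_class A" "invertible A" "c \<noteq> 0" "\<And>v. poly_at F (A *v v) = c * poly_at F v"
    using \<sigma> by (auto simp: carrier_Aut_iff)
  have scalar_pow: "(\<exists>c. \<forall>v. ((*v) A ^^ n) v = c *s v) \<longleftrightarrow> e\<^sup>2 dvd n" for n
    using ord_Aut_eq_iff[OF A(2), of F "e\<^sup>2"] ord \<sigma> A(1) by (simp add: e_def)
  obtain s where s: "\<And>v. ((*v) A ^^ e\<^sup>2) v = s *s v"
    using scalar_pow[THEN iffD2, OF dvd_refl] by blast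
  have "e\<^sup>2 > 0" using e by simp
  then obtain P :: "'k^3^3" and t where P: "invertible P" and t: "\<And>i. t i \<noteq> 0"
    and AP: "\<And>q. A *v (P *v q) = P *v (\<chi> i. t i * q $ i)"
    using scalar_power_diagonalizable[OF A(2) s] by blast
  have pow: "((*v) A ^^ n) (P *v q) = P *v (\<chi> i. t i ^ n * q $ i)" for n q
    by (induction n) (simp_all add: AP mult.assoc)
  \<comment> \<open>If the \<open>n\<close>-th powers of all eigenvalues agree, the
    \<open>n\<close>-th iterate is scalar, so the projective order divides \<open>n\<close>.\<close>
  have t_ord: "e\<^sup>2 dvd n" if eq: "\<And>i j. t i ^ n = t j ^ n" for n
  proof -
    have "((*v) A ^^ n) v = t 1 ^ n *s v" for v
    proof -
      obtain q where v: "v = P *v q"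
        using P by (metis invertible_def matrix_vector_mul_assoc matrix_vector_mul_lid)
      have "(\<chi> i. t i ^ n * q $ i) = t 1 ^ n *s q" using eq by (simp add: vec_eq_iff)
      then show ?thesis by (simp add: v pow vector_scalar_commute)
    qed
    then show ?thesis using scalar_pow by blast
  qed
  define G where "G = lin_subst P F"
  have G: "nonsingular_plane_curve d G"
    unfolding G_def by (rule nonsingular_lin_subst[OF F P])
  have "poly_at G (\<chi> i. t i * q $ i) = c * poly_at G q" for q
    using A(4)[of "P *v q"] by (simp add: G_def AP)
  note weight = mono_at_eq_if_diagonal_invariant[OF this]
  have "\<forall>i. \<exists>j. \<exists>m\<in>Poly_Mapping.keys G.
    \<forall>l. Poly_Mapping.lookup m l = (if l = i then e else 0) + (if l = j then 1 else 0)"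
    unfolding e_def by (intro allI nonsingular_monomial[OF G]) (use d in simp)
  then have "\<exists>f. \<forall>i. \<exists>m\<in>Poly_Mapping.keys G.
    \<forall>l. Poly_Mapping.lookup m l = (if l = i then e else 0) + (if l = f i then 1 else 0)"
    by (rule choice)
  then obtain f where "\<forall>i. \<exists>m. m \<in> Poly_Mapping.keys G \<and>
    (\<forall>l. Poly_Mapping.lookup m l = (if l = i then e else 0) + (if l = f i then 1 else 0))"
    unfolding Bex_def by (elim exE)
  then have "\<exists>M. \<forall>i. M i \<in> Poly_Mapping.keys G \<and>
    (\<forall>l. Poly_Mapping.lookup (M i) l = (if l = i then e else 0) + (if l = f i then 1 else 0))"
    by (rule choice)
  then obtain M where M: "\<And>i. M i \<in> Poly_Mapping.keys G"
    "\<And>i l. Poly_Mapping.lookup (M i) l = (if l = i then e else 0) + (if l = f i then 1 else 0)"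
    by blast
  have tf: "t i ^ e * t (f i) = c" for i
  proof -
    have "mono_at (M i) (\<chi> i. t i) = (\<Prod>l\<in>UNIV. (if l = i then t l ^ e else 1) * (if l = f i then t l else 1))"
      unfolding mono_at_def by (rule prod.cong) (auto simp: M)
    then show ?thesis using weight[OF M(1)[of i]] by (simp add: prod.distrib)
  qed
  \<comment> \<open>The coordinates \<open>i\<close>, \<open>j\<close>, \<open>k\<close> play the
    roles of \<open>X\<close>, \<open>Y\<close>, \<open>Z\<close>: the values of \<open>f\<close>
    give the monomials \<open>X ^ d\<close>, \<open>Y ^ e * Z\<close> and
    \<open>Z ^ e * X\<close>.\<close>
  obtain i j k where ijk: "i \<noteq> j" "j \<noteq> k" "i \<noteq> k" and f: "f i = i" "f j = k" "f k = i"
    using weights_of_large_order[where t = t and f = f and e = e and c = c, OF tf t e(1) t_ord] by blast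
  have UNIV_ijk: "UNIV = {i, j, k}"
    using ijk exhaust_3[of i] exhaust_3[of j] exhaust_3[of k] UNIV_3 by auto
  have mono: "mono_at m v = v $ i ^ Poly_Mapping.lookup m i * v $ j ^ Poly_Mapping.lookup m j * v $ k ^ Poly_Mapping.lookup m k"
    for m and v :: "'k^3"
    unfolding mono_at_def UNIV_ijk using ijk by (simp add: mult.assoc)
  have keys: "m \<in> {M i, M j, M k}" if m: "m \<in> Poly_Mapping.keys G" for m
  proof -
    let ?a = "Poly_Mapping.lookup m i" and ?b = "Poly_Mapping.lookup m j" and ?r = "Poly_Mapping.lookup m k"
    have "(\<Sum>l\<in>UNIV. Poly_Mapping.lookup m l) = d"
      using G m by (auto simp: nonsingular_plane_curve_def homogeneous_def)
    then have deg: "?a + ?b + ?r = e + 1"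
      unfolding UNIV_ijk using ijk e(2) by simp
    \<comment> \<open>Eigenvalues matter only up to a common factor. Normalising the
      \<open>i\<close>-th to 1 leaves \<open>b\<close> and \<open>g\<close>, and the monomial
      \<open>M j\<close> makes \<open>g\<close> the inverse of \<open>b ^ e\<close>.\<close>
    define b g where "b = t j / t i" and "g = t k / t i"
    have b0: "b \<noteq> 0" by (simp add: b_def t)
    have c: "c = t i ^ (e + 1)" using tf[of i] f by (simp add: mult.commute)
    have bg: "b ^ e * g = 1"
      using tf[of j] f t by (simp add: b_def g_def power_divide c)
    have "t i ^ ?a * t j ^ ?b * t k ^ ?r = t i ^ (?a + ?b + ?r)"
      using weight[OF m] by (simp add: mono deg c)
    then have "t j ^ ?b * t k ^ ?r = t i ^ ?b * t i ^ ?r"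
      using t[of i] by (simp add: power_add mult.assoc)
    then have "b ^ ?b * g ^ ?r = 1"
      using t by (simp add: b_def g_def power_divide)
    moreover have "b ^ ?b * (b ^ e * g) ^ ?r = (b ^ ?b * g ^ ?r) * b ^ (e * ?r)"
      by (simp add: power_mult_distrib power_mult mult_ac)
    ultimately have b_eq: "b ^ ?b = b ^ (e * ?r)" by (simp add: bg)
    \<comment> \<open>As \<open>g\<close> is determined by \<open>b\<close>, a power trivialising
      \<open>b\<close> makes all eigenvalues agree, so \<open>b\<close> carries the full
      order.\<close>
    have b_ord: "e\<^sup>2 dvd n" if "b ^ n = 1" for n
    proof -
      have "(b ^ e * g) ^ n = (b ^ n) ^ e * g ^ n"
        by (simp add: power_mult_distrib mult.commute flip: power_mult)
      then have "g ^ n = 1" by (simp add: bg that)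
      then have "t j ^ n = t i ^ n" "t k ^ n = t i ^ n"
        using that t by (simp_all add: b_def g_def power_divide)
      moreover have "l = i \<or> l = j \<or> l = k" for l using UNIV_ijk by auto
      ultimately have "t l ^ n = t i ^ n" for l by metis
      then show ?thesis by (intro t_ord) metis
    qed
    have "int e ^ 2 dvd int ?b - int e * int ?r"
    proof (cases "e * ?r \<le> ?b")
      case True
      then have "b ^ (?b - e * ?r) = 1" using b_eq b0 by (simp add: power_diff)
      then have "int (e\<^sup>2) dvd int (?b - e * ?r)" using b_ord by (simp only: int_dvd_int_iff)
      then show ?thesis using True by (simp add: of_nat_diff)
    next
      case False
      then have "b ^ (e * ?r - ?b) = 1" using b_eq b0 by (simp add: power_diff)
      then have "int (e\<^sup>2) dvd int (e * ?r - ?b)" using b_ord by (simp only: int_dvd_int_iff)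
      then show ?thesis using False by (simp add: of_nat_diff dvd_diff_commute)
    qed
    from model_monomials[OF e(1) deg this]
    have "(\<forall>l\<in>{i, j, k}. Poly_Mapping.lookup m l = Poly_Mapping.lookup (M i) l) \<or>
      (\<forall>l\<in>{i, j, k}. Poly_Mapping.lookup m l = Poly_Mapping.lookup (M j) l) \<or>
      (\<forall>l\<in>{i, j, k}. Poly_Mapping.lookup m l = Poly_Mapping.lookup (M k) l)"
      using deg ijk by (auto simp: M f)
    then show ?thesis
      unfolding UNIV_ijk[symmetric] by (auto intro: poly_mapping_eqI)
  qed
  have distinct: "M i \<noteq> M j" "M j \<noteq> M k" "M i \<noteq> M k"
    using M(2)[of i i] M(2)[of j i] M(2)[of k i] M(2)[of j j] M(2)[of k j] ijk f e(1) by auto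
  define \<beta> \<gamma> \<delta> where "\<beta> = Poly_Mapping.lookup G (M i)" and "\<gamma> = Poly_Mapping.lookup G (M j)"
    and "\<delta> = Poly_Mapping.lookup G (M k)"
  have nz: "\<beta> \<noteq> 0" "\<gamma> \<noteq> 0" "\<delta> \<noteq> 0"
    using M(1) by (auto simp: \<beta>_def \<gamma>_def \<delta>_def in_keys_iff)
  have G_at: "poly_at G w = \<beta> * w $ i ^ d + \<gamma> * (w $ j ^ e * w $ k) + \<delta> * (w $ i * w $ k ^ e)" for w
  proof -
    have "Poly_Mapping.keys G = {M i, M j, M k}" using keys M(1) by blast
    then show ?thesis
      using distinct ijk by (simp add: poly_at_eq mono M(2) f \<beta>_def \<gamma>_def \<delta>_def e(2) algebra_simps)
  qed
  have "e > 0" using e by simp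
  \<comment> \<open>Scaling \<open>Y\<close> by \<mu> turns the coefficient \<gamma> into
    \<open>\<gamma> * \<mu> ^ e = \<beta>\<close>; dividing the form by \<beta> leaves the parameter
    \<open>\<delta> / \<beta>\<close>.\<close>
  then obtain \<mu> where \<mu>: "\<mu> ^ e = \<beta> / \<gamma>" using nth_root_exists by blast
  then have "\<mu> \<noteq> 0" using nz \<open>e > 0\<close> by (auto simp: power_0_left)
  \<comment> \<open>\<open>R\<close> sends the standard axes to the axes \<open>i\<close>,
    \<open>j\<close>, \<open>k\<close>, the second one scaled by \<mu>.\<close>
  define R :: "'k^3^3" where
    "R = (\<chi> a b. if a = i \<and> b = 1 \<or> a = k \<and> b = 3 then 1 else if a = j \<and> b = 2 then \<mu> else 0)"
  have "det R \<noteq> 0"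
    using ijk exhaust_3[of i] exhaust_3[of j] exhaust_3[of k] \<open>\<mu> \<noteq> 0\<close> unfolding det_3 R_def
    by (elim disjE) simp_all
  then have R: "invertible R" by (simp add: invertible_det_nz)
  have Rv: "(R *v v) $ i = v $ 1" "(R *v v) $ j = \<mu> * v $ 2" "(R *v v) $ k = v $ 3" for v
    using ijk by (simp_all add: matrix_vector_mult_3 R_def)
  have "poly_at F ((P ** R) *v v) = \<beta> * poly_at (model_form d (\<delta> / \<beta>)) v" for v
  proof -
    have "poly_at F ((P ** R) *v v) = poly_at G (R *v v)"
      by (simp add: G_def flip: matrix_vector_mul_assoc)
    also have "\<dots> = \<beta> * v $ 1 ^ d + \<gamma> * \<mu> ^ e * (v $ 2 ^ e * v $ 3) + \<delta> * (v $ 1 * v $ 3 ^ e)"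
      by (simp add: G_at Rv power_mult_distrib mult.assoc)
    finally show ?thesis
      using nz by (simp add: poly_at_model_form \<mu> distrib_left mult.assoc e(2))
  qed
  then have "isomorphic_curves F (model_form d (\<delta> / \<beta>))"
    unfolding isomorphic_curves_def lin_subst_eq_Const_mult_iff
    using invertible_mult[OF P R] nz(1) by blast
  then show ?thesis using nz by (intro exI[of _ "\<delta> / \<beta>"]) simp
qed

section \<open>The automorphism group of the model\<close>

text \<open>For non-zero \<open>w\<close> the third entry is the one that keeps
  \<open>Y ^ e * Z\<close> fixed; \<open>X * Z ^ e\<close> is then fixed exactly when
  \<open>w ^ (e\<^sup>2) = 1\<close>.\<close>

definition diag_matrix :: "nat \<Rightarrow> 'k::field \<Rightarrow> 'k^3^3" where
  "diag_matrix e w = (\<chi> i j. if i = j then (if i = 1 then 1 else if i = 2 then w else inverse w ^ e) else 0)"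

lemma diag_matrix_mult_vec: "diag_matrix e w *v v = vector [v $ 1, w * v $ 2, inverse w ^ e * v $ 3]"
  by (simp add: vec_eq_iff forall_3 matrix_vector_mult_def sum_3 diag_matrix_def)

lemma poly_at_model_form_diag_matrix:
  fixes w :: "'k::field"
  assumes "w ^ (e\<^sup>2) = 1" "w \<noteq> 0"
  shows "poly_at (model_form (Suc e) \<alpha>) (diag_matrix e w *v v) = poly_at (model_form (Suc e) \<alpha>) v"
proof -
  have 1: "w ^ e * inverse w ^ e = 1" using assms(2) by (simp flip: power_mult_distrib)
  have "(inverse w ^ e) ^ e = inverse (w ^ (e\<^sup>2))" by (simp add: power2_eq_square power_inverse power_mult)
  then have 2: "(inverse w ^ e) ^ e = 1" using assms(1) by simp
  have "(w * y) ^ e * (inverse w ^ e * z) = (w ^ e * inverse w ^ e) * (y ^ e * z)" for y z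
    by (simp add: power_mult_distrib mult_ac)
  moreover have "(inverse w ^ e * z) ^ e = (inverse w ^ e) ^ e * z ^ e" for z
    by (rule power_mult_distrib)
  ultimately show ?thesis
    by (simp only: poly_at_model_form diag_matrix_mult_vec vector_3 diff_Suc_1 1 2 mult_1)
qed

lemma model_form_preserving_diagonal:
  fixes A :: "'k::field_char_0^3^3"
  assumes A: "invertible A" and e: "e \<ge> 3" and "\<alpha> \<noteq> 0" and "c \<noteq> 0"
    and inv: "\<And>v. poly_at (model_form (Suc e) \<alpha>) (A *v v) = c * poly_at (model_form (Suc e) \<alpha>) v"
  shows "\<exists>a w. a \<noteq> 0 \<and> w ^ (e\<^sup>2) = 1 \<and> (\<forall>v. A *v v = a *s (diag_matrix e w *v v))"
proof -
  obtain n where n: "e = n + 3" using e by (metis add.commute le_Suc_ex)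
  have model: "poly_at (model_form (Suc e) \<alpha>) v = model_poly n \<alpha> (v $ 1) (v $ 2) (v $ 3)" for v
    by (simp add: poly_at_model_form model_poly_def n add.commute)
  have "A $ 1 $ 2 = 0 \<and> A $ 1 $ 3 = 0 \<and> A $ 2 $ 1 = 0 \<and> A $ 2 $ 3 = 0 \<and> A $ 3 $ 1 = 0 \<and> A $ 3 $ 2 = 0 \<and>
    (A $ 1 $ 1) ^ (n + 4) = c \<and> (A $ 2 $ 2) ^ (n + 3) * A $ 3 $ 3 = c \<and> A $ 1 $ 1 * (A $ 3 $ 3) ^ (n + 3) = c"
  proof (rule model_poly_preserving_diagonal)
    fix x y z
    show "model_poly n \<alpha> (A $ 1 $ 1 * x + A $ 1 $ 2 * y + A $ 1 $ 3 * z)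
       (A $ 2 $ 1 * x + A $ 2 $ 2 * y + A $ 2 $ 3 * z)
       (A $ 3 $ 1 * x + A $ 3 $ 2 * y + A $ 3 $ 3 * z) = c * model_poly n \<alpha> x y z"
      using inv[of "vector [x, y, z]"] by (simp add: model matrix_vector_mult_3)
  qed (use A \<open>\<alpha> \<noteq> 0\<close> in \<open>simp_all add: invertible_det_nz det_3\<close>)
  then have zero: "A $ 1 $ 2 = 0" "A $ 1 $ 3 = 0" "A $ 2 $ 1 = 0" "A $ 2 $ 3 = 0" "A $ 3 $ 1 = 0" "A $ 3 $ 2 = 0"
    and c: "A $ 1 $ 1 * (A $ 1 $ 1) ^ e = c" "(A $ 2 $ 2) ^ e * A $ 3 $ 3 = c" "A $ 1 $ 1 * (A $ 3 $ 3) ^ e = c"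
    by (auto simp: n numeral_eq_Suc)
  \<comment> \<open>Up to the scalar \<open>a\<close> the matrix is given by the ratios
    \<open>w\<close> and \<open>g\<close>, for which the three coefficient equations become
    \<open>w ^ e * g = 1\<close> and \<open>g ^ e = 1\<close>.\<close>
  define a w g where "a = A $ 1 $ 1" and "w = A $ 2 $ 2 / a" and "g = A $ 3 $ 3 / a"
  have a0: "a \<noteq> 0" using c(1) \<open>c \<noteq> 0\<close> by (auto simp: a_def)
  have A_eq: "A $ 1 $ 1 = a" "A $ 2 $ 2 = a * w" "A $ 3 $ 3 = a * g"
    using a0 by (simp_all add: a_def w_def g_def)
  have "a * a ^ e * (w ^ e * g) = (a * w) ^ e * (a * g)" "a * a ^ e * g ^ e = a * (a * g) ^ e"
    by (simp_all add: power_mult_distrib mult_ac)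
  then have "c * (w ^ e * g) = c" "c * g ^ e = c" using c unfolding A_eq by metis+
  then have wg: "w ^ e * g = 1" "g ^ e = 1" using \<open>c \<noteq> 0\<close> by simp_all
  then have w0: "w \<noteq> 0" using e by (auto simp: power_0_left)
  then have g: "g = inverse w ^ e" using wg(1) by (simp add: power_inverse field_simps)
  have "w ^ (e\<^sup>2) * g ^ e = 1"
    using wg(1) by (metis power2_eq_square power_mult power_mult_distrib power_one)
  then have "w ^ (e\<^sup>2) = 1" by (simp add: wg(2))
  moreover have "A *v v = a *s (diag_matrix e w *v v)" for v
    by (simp add: vec_eq_iff forall_3 matrix_vector_mult_3[of A] zero A_eq diag_matrix_mult_vec mult.assoc flip: g)
  ultimately show ?thesis using a0 by blast
qed

text \<open>Conjugation by the coordinate change \<open>B\<close> carries the diagonal automorphisms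
  of the model to the automorphisms of \<open>F\<close>; the one for a primitive
  \<open>e\<^sup>2\<close>-th root of unity generates.\<close>

lemma Aut_cyclic_if_isomorphic_model_form:
  fixes F :: "'k::{alg_closed_field, field_char_0} tpoly"
  assumes d: "d \<ge> 4" and \<alpha>: "\<alpha> \<noteq> 0" and iso: "isomorphic_curves F (model_form d \<alpha>)"
  shows "\<exists>\<sigma>\<in>carrier (Aut F). group.ord (Aut F) \<sigma> = (d - 1)\<^sup>2 \<and>
    carrier (Aut F) = range (\<lambda>n::int. \<sigma> [^]\<^bsub>Aut F\<^esub> n)"
proof -
  interpret Aut: group "Aut F" by (rule group_Aut)
  define e where "e = d - 1"
  have e: "e \<ge> 3" "d = Suc e" "e\<^sup>2 > 0" using d by (auto simp: e_def)
  obtain B c where B: "invertible B" "c \<noteq> 0" "\<And>v. poly_at F (B *v v) = c * poly_at (model_form d \<alpha>) v"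
    using iso unfolding isomorphic_curves_def lin_subst_eq_Const_mult_iff by blast
  obtain C where C: "B ** C = mat 1" "C ** B = mat 1" using B(1) by (auto simp: invertible_def)
  then have invC: "invertible C" by (auto simp: invertible_def)
  have BC: "B *v (C *v v) = v" "C *v (B *v v) = v" for v
    by (simp_all add: matrix_vector_mul_assoc C)
  obtain \<zeta> :: 'k where \<zeta>: "\<zeta> ^ k = 1 \<longleftrightarrow> e\<^sup>2 dvd k" for k
    using exists_primitive_root_of_unity[OF e(3)] by blast
  have \<zeta>1: "\<zeta> ^ (e\<^sup>2) = 1" by (simp add: \<zeta>)
  then have \<zeta>0: "\<zeta> \<noteq> 0" using e(3) by (auto simp: power_0_left)
  define S where "S = B ** diag_matrix e \<zeta> ** C"
  have S: "S *v v = B *v (diag_matrix e \<zeta> *v (C *v v))" for v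
    by (simp add: S_def matrix_vector_mul_assoc matrix_mul_assoc)
  have S_pow: "((*v) S ^^ n) v = B *v (diag_matrix e (\<zeta> ^ n) *v (C *v v))" for n v
  proof (induction n)
    case 0
    have "diag_matrix e 1 *v u = u" for u :: "'k^3"
      by (simp add: diag_matrix_mult_vec vec_eq_iff forall_3)
    then show ?case by (simp add: BC)
  next
    case (Suc n)
    have "diag_matrix e \<zeta> *v (diag_matrix e (\<zeta> ^ n) *v u) = diag_matrix e (\<zeta> ^ Suc n) *v u" for u
      by (simp add: diag_matrix_mult_vec vec_eq_iff forall_3 power_mult_distrib mult.assoc)
    note diag = this
    have "((*v) S ^^ Suc n) v = S *v (B *v (diag_matrix e (\<zeta> ^ n) *v (C *v v)))"
      by (simp add: Suc.IH)
    also have "\<dots> = B *v (diag_matrix e \<zeta> *v (C *v (B *v (diag_matrix e (\<zeta> ^ n) *v (C *v v)))))"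
      by (rule S)
    also have "\<dots> = B *v (diag_matrix e (\<zeta> ^ Suc n) *v (C *v v))" unfolding BC diag ..
    finally show ?case .
  qed
  have "det (diag_matrix e \<zeta>) \<noteq> 0" using \<zeta>0 by (simp add: det_3 diag_matrix_def)
  then have "invertible S"
    unfolding S_def by (intro invertible_mult B(1) invC) (simp add: invertible_det_nz)
  have "poly_at F (S *v v) = 1 * poly_at F v" for v
    using B(3)[of "C *v v"] poly_at_model_form_diag_matrix[OF \<zeta>1 \<zeta>0]
    by (simp add: S B(3) BC e(2))
  then have mem: "pgl_class S \<in> carrier (Aut F)"
    unfolding carrier_Aut_iff using \<open>invertible S\<close> one_neq_zero by blast
  have "(\<exists>c. \<forall>v. ((*v) S ^^ n) v = c *s v) \<longleftrightarrow> e\<^sup>2 dvd n" for n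
  proof
    assume "\<exists>c. \<forall>v. ((*v) S ^^ n) v = c *s v"
    then obtain b where b: "\<And>v. B *v (diag_matrix e (\<zeta> ^ n) *v (C *v v)) = b *s v"
      unfolding S_pow by blast
    have "diag_matrix e (\<zeta> ^ n) *v u = b *s u" for u
    proof -
      have "diag_matrix e (\<zeta> ^ n) *v u = C *v (B *v (diag_matrix e (\<zeta> ^ n) *v (C *v (B *v u))))"
        by (simp add: BC)
      also have "\<dots> = b *s u" unfolding b by (simp add: vector_scalar_commute BC)
      finally show ?thesis .
    qed
    \<comment> \<open>The first coordinate of the test vector gives \<open>b = 1\<close>, the second
      \<open>\<zeta> ^ n = b\<close>.\<close>
    from this[of "vector [1, 1, 1]"] have "\<zeta> ^ n = 1"
      by (simp add: diag_matrix_mult_vec vec_eq_iff forall_3)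
    then show "e\<^sup>2 dvd n" by (simp add: \<zeta>)
  next
    assume "e\<^sup>2 dvd n"
    then have "\<zeta> ^ n = 1" by (simp add: \<zeta>)
    moreover have "diag_matrix e 1 *v u = u" for u :: "'k^3"
      by (simp add: diag_matrix_mult_vec vec_eq_iff forall_3)
    ultimately have "\<forall>v. ((*v) S ^^ n) v = 1 *s v" by (simp add: S_pow BC)
    then show "\<exists>c. \<forall>v. ((*v) S ^^ n) v = c *s v" by blast
  qed
  then have ord: "group.ord (Aut F) (pgl_class S) = e\<^sup>2"
    unfolding ord_Aut_eq_iff[OF \<open>invertible S\<close> mem] by (rule allI)
  have "T \<in> range (\<lambda>n::int. pgl_class S [^]\<^bsub>Aut F\<^esub> n)" if T: "T \<in> carrier (Aut F)" for T
  proof -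
    obtain A b where A: "T = pgl_class A" "invertible A" "b \<noteq> 0" "\<And>v. poly_at F (A *v v) = b * poly_at F v"
      using T unfolding carrier_Aut_iff by blast
    let ?M = "C ** A ** B"
    have M: "?M *v v = C *v (A *v (B *v v))" for v
      by (simp add: matrix_vector_mul_assoc matrix_mul_assoc)
    have invM: "invertible ?M" by (intro invertible_mult invC A(2) B(1))
    have "poly_at (model_form (Suc e) \<alpha>) (?M *v v) = b * poly_at (model_form (Suc e) \<alpha>) v" for v
      using B(3)[of "?M *v v"] A(4)[of "B *v v"] B(2,3) by (simp add: M BC e(2))
    then obtain a w where aw: "a \<noteq> 0" "w ^ (e\<^sup>2) = 1" "\<And>v. ?M *v v = a *s (diag_matrix e w *v v)"
      using model_form_preserving_diagonal[OF invM e(1) \<alpha> A(3)] by blast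
    obtain k where k: "w = \<zeta> ^ k" using root_of_unity_eq_power[OF \<zeta> e(3) aw(2)] by blast
    have "A *v v = a *s ((S [^]\<^bsub>GL3\<^esub> k) *v v)" for v
    proof -
      have "A *v v = B *v (?M *v (C *v v))" by (simp add: M BC)
      then show ?thesis by (simp add: aw(3) k GL3_pow_mult_vec S_pow vector_scalar_commute)
    qed
    then have "T = pgl_class (S [^]\<^bsub>GL3\<^esub> k)" unfolding A(1) by (rule pgl_class_eqI[OF aw(1)])
    also have "\<dots> = pgl_class S [^]\<^bsub>Aut F\<^esub> int k"
      by (simp add: int_pow_int Aut_pow pgl_class_pow[OF \<open>invertible S\<close>])
    finally show ?thesis by blast
  qed
  then have "carrier (Aut F) = range (\<lambda>n::int. pgl_class S [^]\<^bsub>Aut F\<^esub> n)"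
    using mem Aut.int_pow_closed by blast
  then show ?thesis using mem ord by (intro bexI[of _ "pgl_class S"]) (simp_all add: e_def)
qed

section \<open>The equivalence, cyclicity and the statement on subgroups\<close>

theorem proposition40:
  fixes F :: "'k::{alg_closed_field, field_char_0} tpoly" and d :: nat
  assumes "d \<ge> 4" and "nonsingular_plane_curve d F"
  shows "((\<exists>\<sigma>\<in>carrier (Aut F). group.ord (Aut F) \<sigma> = (d - 1)\<^sup>2) \<longleftrightarrow>
            (\<exists>\<alpha>. \<alpha> \<noteq> 0 \<and> isomorphic_curves F (model_form d \<alpha>)))
       \<and> ((\<exists>\<alpha>. \<alpha> \<noteq> 0 \<and> isomorphic_curves F (model_form d \<alpha>)) \<longrightarrow>
            cyclic_group (Aut F) \<and> order (Aut F) = (d - 1)\<^sup>2)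
       \<and> (\<forall>(E :: 'k tpoly) G.
            nonsingular_plane_curve d E \<and> subgroup G (Aut E)
              \<and> \<not> cyclic_group ((Aut E)\<lparr>carrier := G\<rparr>) \<and> (d - 1)\<^sup>2 dvd card G
            \<longrightarrow> \<not> (\<exists>\<sigma>\<in>G. group.ord (Aut E) \<sigma> = (d - 1)\<^sup>2))"
proof -
  have cyclic: "cyclic_group (Aut E) \<and> order (Aut E) = (d - 1)\<^sup>2"
    if iso: "\<exists>\<alpha>. \<alpha> \<noteq> 0 \<and> isomorphic_curves E (model_form d \<alpha>)" for E :: "'k tpoly"
  proof -
    interpret Aut: group "Aut E" by (rule group_Aut)
    obtain \<alpha> where \<alpha>: "\<alpha> \<noteq> 0" "isomorphic_curves E (model_form d \<alpha>)" using iso by blast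
    obtain \<sigma> where \<sigma>: "\<sigma> \<in> carrier (Aut E)" "Aut.ord \<sigma> = (d - 1)\<^sup>2"
      "carrier (Aut E) = range (\<lambda>n::int. \<sigma> [^]\<^bsub>Aut E\<^esub> n)"
      using Aut_cyclic_if_isomorphic_model_form[OF assms(1) \<alpha>] by blast
    then have "cyclic_group (Aut E)" using Aut.cyclic_group by blast
    moreover have "order (Aut E) = (d - 1)\<^sup>2"
      using Aut.cyclic_order_is_ord[OF \<sigma>(1)] Aut.carrier_subgroup_generated_by_singleton[OF \<sigma>(1)] \<sigma>(2,3)
      by (simp add: order_def)
    ultimately show ?thesis ..
  qed
  \<comment> \<open>An element of this order makes \<open>E\<close> isomorphic to a model, so
    \<open>Aut E\<close> is cyclic of order \<open>(d - 1)\<^sup>2\<close>. The element then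
    generates all of it, hence \<open>G\<close> is the whole group and is cyclic after all.\<close>
  have no_large: "\<not> (\<exists>\<sigma>\<in>G. group.ord (Aut E) \<sigma> = (d - 1)\<^sup>2)"
    if E: "nonsingular_plane_curve d E" and G: "subgroup G (Aut E)"
      and not_cyclic: "\<not> cyclic_group ((Aut E)\<lparr>carrier := G\<rparr>)" for E :: "'k tpoly" and G
  proof
    interpret Aut: group "Aut E" by (rule group_Aut)
    assume "\<exists>\<sigma>\<in>G. Aut.ord \<sigma> = (d - 1)\<^sup>2"
    then obtain \<sigma> where \<sigma>: "\<sigma> \<in> G" "Aut.ord \<sigma> = (d - 1)\<^sup>2" by blast
    then have mem: "\<sigma> \<in> carrier (Aut E)" using subgroup.subset[OF G] by blast
    then have cyc: "cyclic_group (Aut E)" "order (Aut E) = (d - 1)\<^sup>2"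
      using cyclic isomorphic_model_form_if_element_of_large_order[OF E assms(1) mem \<sigma>(2)] by blast+
    have "(d - 1)\<^sup>2 > 0" using assms(1) by simp
    then have fin: "finite (carrier (Aut E))"
      using cyc(2) by (simp add: order_def card_ge_0_finite)
    have "card (generate (Aut E) {\<sigma>}) = card (carrier (Aut E))"
      using Aut.generate_pow_card[OF mem] \<sigma>(2) cyc(2) by (simp add: order_def)
    moreover have "generate (Aut E) {\<sigma>} \<subseteq> G"
      using \<sigma>(1) G by (intro Aut.generate_subgroup_incl) auto
    ultimately have "carrier (Aut E) \<subseteq> G"
      using card_subset_eq[OF fin, of "generate (Aut E) {\<sigma>}"] subgroup.subset[OF G] by auto
    then have "G = carrier (Aut E)" using subgroup.subset[OF G] by (rule subset_antisym[rotated])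
    then show False using not_cyclic cyc(1) by simp
  qed
  show ?thesis
  proof (intro conjI impI allI iffI)
    assume "\<exists>\<sigma>\<in>carrier (Aut F). group.ord (Aut F) \<sigma> = (d - 1)\<^sup>2"
    then show "\<exists>\<alpha>. \<alpha> \<noteq> 0 \<and> isomorphic_curves F (model_form d \<alpha>)"
      by (elim bexE) (rule isomorphic_model_form_if_element_of_large_order[OF assms(2,1)])
  next
    assume "\<exists>\<alpha>. \<alpha> \<noteq> 0 \<and> isomorphic_curves F (model_form d \<alpha>)"
    then obtain \<alpha> where "\<alpha> \<noteq> 0" "isomorphic_curves F (model_form d \<alpha>)" by (elim exE conjE)
    from Aut_cyclic_if_isomorphic_model_form[OF assms(1) this]
    show "\<exists>\<sigma>\<in>carrier (Aut F). group.ord (Aut F) \<sigma> = (d - 1)\<^sup>2" by (elim bexE conjE) (rule bexI)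
  next
    fix E :: "'k tpoly" and G
    assume "nonsingular_plane_curve d E \<and> subgroup G (Aut E) \<and>
      \<not> cyclic_group ((Aut E)\<lparr>carrier := G\<rparr>) \<and> (d - 1)\<^sup>2 dvd card G"
    then show "\<not> (\<exists>\<sigma>\<in>G. group.ord (Aut E) \<sigma> = (d - 1)\<^sup>2)"
      by (elim conjE) (rule no_large)
  qed (use cyclic in \<open>simp_all only:\<close>)
qed

end
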